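(* Fix constants $\beta>0$ and $\gamma>0$, and for each $n$ let $\mathcal{G}^{(n)}:=\mathcal{G}^{(n)}_{\lfloor\beta n\rfloor,\gamma/n}$ be the random intersection graph on $n$ vertices with $m=\lfloor \beta n\rfloor$ auxiliary vertices and $p=\gamma/n$. Let $\mu:=\beta\gamma^2$, and let $\rho$ be the smallest non-negative root of $\rho=g(\rho)$, where $g(s)=\exp\{\beta\gamma(e^{\gamma(s-1)}-1)\}$. (i) If $\mu<1$, then there is a constant $K=K(\beta,\gamma)$ such that, with probability tending to $1$ as $n\to\infty$, every connected component of $\mathcal{G}^{(n)}$ has at most $K\log n$ vertices. (ii) If $\mu>1$, then $0<\rho<1$; with probability tending to $1$ there is a unique connected component (the giant component) whose number of vertices $L_1^{(n)}$ satisfies $L_1^{(n)}/n\to 1-\rho$ in probability; and there is a constant $K=K(\beta,\gamma)$ such that, with probability tending to $1$, every other connected component has at most $K\log n$ vertices.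
   Context: The random intersection graph $\mathcal{G}^{(n)}_{m,p}$ has vertex set $\mathcal{V}=\{v_1,\dots,v_n\}$. It is built from a random bipartite graph on $\mathcal{V}$ and a set $\mathcal{A}=\{a_1,\dots,a_m\}$ of auxiliary vertices, in which each of the $nm$ possible edges $v_ia_k$ is present independently with probability $p$. Two distinct vertices $v_i,v_j$ are adjacent in $\mathcal{G}^{(n)}_{m,p}$ if and only if some auxiliary vertex $a_k$ is adjacent to both in the bipartite graph. The function $g$ is the probability generating function of the compound Poisson distribution $\mathrm{CPoisson}(\beta\gamma,\gamma)$, i.e. the law of a sum of a $\mathrm{Poisson}(\beta\gamma)$ number of independent $\mathrm{Poisson}(\gamma)$ variables; $\mu$ is the mean of this distribution and is the limiting expected degree of a vertex of $\mathcal{G}^{(n)}$. *)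

theory Defs
  imports "HOL-Probability.Product_PMF"
begin

definition bip_pmf :: "nat \<Rightarrow> nat \<Rightarrow> real \<Rightarrow> (nat \<times> nat \<Rightarrow> bool) pmf" where
  "bip_pmf n m p = Pi_pmf ({..<n} \<times> {..<m}) False (\<lambda>_. bernoulli_pmf p)"

definition rig_adj :: "nat \<Rightarrow> nat \<Rightarrow> (nat \<times> nat \<Rightarrow> bool) \<Rightarrow> nat \<Rightarrow> nat \<Rightarrow> bool" where
  "rig_adj n m B i j \<longleftrightarrow> i < n \<and> j < n \<and> i \<noteq> j \<and> (\<exists>k<m. B (i, k) \<and> B (j, k))"

definition rig_components :: "nat \<Rightarrow> nat \<Rightarrow> (nat \<times> nat \<Rightarrow> bool) \<Rightarrow> nat set set" where
  "rig_components n m B = {{u. (rig_adj n m B)\<^sup>*\<^sup>* v u} | v. v < n}"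

definition largest_comp :: "nat \<Rightarrow> nat \<Rightarrow> (nat \<times> nat \<Rightarrow> bool) \<Rightarrow> nat" where
  "largest_comp n m B = Max (card ` rig_components n m B)"

definition aux_num :: "real \<Rightarrow> nat \<Rightarrow> nat" where
  "aux_num \<beta> n = nat \<lfloor>\<beta> * real n\<rfloor>"

definition rig_pmf :: "real \<Rightarrow> real \<Rightarrow> nat \<Rightarrow> (nat \<times> nat \<Rightarrow> bool) pmf" where
  "rig_pmf \<beta> \<gamma> n = bip_pmf n (aux_num \<beta> n) (\<gamma> / real n)"

text \<open>The generating function g of CPoisson(beta gamma, gamma).\<close>
definition g_cp :: "real \<Rightarrow> real \<Rightarrow> real \<Rightarrow> real" where
  "g_cp \<beta> \<gamma> s = exp (\<beta> * \<gamma> * (exp (\<gamma> * (s - 1)) - 1))"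

definition rho_ext :: "real \<Rightarrow> real \<Rightarrow> real" where
  "rho_ext \<beta> \<gamma> = Inf {s. 0 \<le> s \<and> g_cp \<beta> \<gamma> s = s}"

end

theory Submission
  imports Defs "HOL-Real_Asymp.Real_Asymp"
begin

text \<open>The expected number of \<open>r\<close>-tuples of vertices whose components together have \<open>k\<close> vertices
  and \<open>l\<close> auxiliary vertices is \<open>(n choose k) (m choose l) (1 - p)\<^sup>e \<Phi>\<close> with
  \<open>e = k (m - l) + l (n - k)\<close>, where \<open>\<Phi>\<close> depends only on \<open>k\<close>, \<open>l\<close>, \<open>r\<close> and \<open>p\<close>. It is at
  most \<open>n'\<^sup>r\<close> in a graph of any other size \<open>n'\<close>, \<open>m'\<close> with the same \<open>p\<close>, which bounds \<open>\<Phi>\<close> without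
  any exploration of components.

  Changing \<open>n\<close> or \<open>m\<close> by a small proportion shows that the expectation is at most
  \<open>O(n\<^sup>r) exp (- c (k + l))\<close> unless \<open>1 - k/n\<close> is close to \<open>(1 - p)\<^sup>l\<close> and \<open>1 - l/m\<close> to
  \<open>(1 - p)\<^sup>k\<close>, relative to \<open>(k + l)/n\<close>. These conditions make \<open>1 - k/n\<close> an approximate fixed
  point of \<open>g\<close>. In the subcritical case there is none apart from \<open>1\<close>; in the supercritical case
  \<open>k/n\<close> must be close to \<open>1 - \<rho>\<close>. Applied to pairs (\<open>r = 2\<close>), this also excludes two large
  components, because their union would have about \<open>2 (1 - \<rho>) n\<close> vertices.

  A large component exists with high probability: if all components were of size \<open>O(log n)\<close>, all
  \<open>r\<close>-tuples would be in small components, but for \<open>\<rho> < \<sigma> < 1\<close> and a suitable \<open>m'\<close> the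
  expected number of such tuples is at most the one for \<open>n' \<approx> \<sigma> n\<close>, hence at most
  about \<open>(\<sigma> n)\<^sup>r\<close>. So this has probability at most about \<open>\<sigma>\<^sup>r\<close>, for every \<open>r\<close>.\<close>

subsection \<open>Components of bipartite graphs\<close>

text \<open>Loops are allowed, which does not affect reachability. Arbitrary sets \<open>V\<close>
  and \<open>W\<close> make it possible to restrict the graph to a union of its components.\<close>

definition adj :: "nat set \<Rightarrow> nat set \<Rightarrow> (nat \<times> nat \<Rightarrow> bool) \<Rightarrow> nat \<Rightarrow> nat \<Rightarrow> bool" where
  "adj V W B i j \<longleftrightarrow> i \<in> V \<and> j \<in> V \<and> (\<exists>k\<in>W. B (i, k) \<and> B (j, k))"

text \<open>For \<open>T\<close> inside \<open>V\<close> this is the union of the components meeting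
  \<open>T\<close>, so a vertex, a pair and an \<open>r\<close>-tuple are treated alike.\<close>

definition vclosure :: "nat set \<Rightarrow> nat set \<Rightarrow> (nat \<times> nat \<Rightarrow> bool) \<Rightarrow> nat set \<Rightarrow> nat set" where
  "vclosure V W B T = {u. \<exists>v\<in>T. (adj V W B)\<^sup>*\<^sup>* v u}"

definition aclosure :: "nat set \<Rightarrow> nat set \<Rightarrow> (nat \<times> nat \<Rightarrow> bool) \<Rightarrow> nat set \<Rightarrow> nat set" where
  "aclosure V W B T = {k\<in>W. \<exists>i\<in>vclosure V W B T. B (i, k)}"

definition closed_pair ::
  "nat set \<Rightarrow> nat set \<Rightarrow> nat set \<Rightarrow> nat set \<Rightarrow> (nat \<times> nat \<Rightarrow> bool) \<Rightarrow> bool" where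
  "closed_pair V W A L B \<longleftrightarrow> (\<forall>z \<in> A \<times> (W - L) \<union> (V - A) \<times> L. \<not> B z)"

lemma symp_adj: "symp (adj V W B)"
  by (auto intro!: sympI simp: adj_def)

lemma rtranclp_rig_adj: "(rig_adj n m B)\<^sup>*\<^sup>* = (adj {..<n} {..<m} B)\<^sup>*\<^sup>*"
proof -
  have "(rig_adj n m B)\<^sup>=\<^sup>= = (adj {..<n} {..<m} B)\<^sup>=\<^sup>="
    by (auto simp: fun_eq_iff rig_adj_def adj_def)
  then show ?thesis
    by (metis rtranclp_reflclp)
qed

lemma rig_components_eq: "rig_components n m B = (\<lambda>v. vclosure {..<n} {..<m} B {v}) ` {..<n}"
  unfolding rig_components_def vclosure_def rtranclp_rig_adj by auto

lemma subset_vclosure: "T \<subseteq> vclosure V W B T"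
  by (auto simp: vclosure_def)

lemma adj_rtranclp_mem: "(adj V W B)\<^sup>*\<^sup>* v u \<Longrightarrow> v \<in> V \<Longrightarrow> u \<in> V"
  by (induction rule: rtranclp_induct) (auto simp: adj_def)

lemma vclosure_subset: "T \<subseteq> V \<Longrightarrow> vclosure V W B T \<subseteq> V"
  by (auto simp: vclosure_def dest: adj_rtranclp_mem)

lemma aclosure_subset: "aclosure V W B T \<subseteq> W"
  by (auto simp: aclosure_def)

lemma vclosure_UN: "vclosure V W B T = (\<Union>v\<in>T. vclosure V W B {v})"
  by (auto simp: vclosure_def)

lemma aclosure_UN: "aclosure V W B T = (\<Union>v\<in>T. aclosure V W B {v})"
  by (auto simp: vclosure_def aclosure_def)

lemma vclosure_eq_or_disjoint: "vclosure V W B {u} = vclosure V W B {v} \<or> vclosure V W B {u} \<inter> vclosure V W B {v} = {}"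
proof (rule disjCI)
  assume "vclosure V W B {u} \<inter> vclosure V W B {v} \<noteq> {}"
  then obtain x where x: "(adj V W B)\<^sup>*\<^sup>* u x" "(adj V W B)\<^sup>*\<^sup>* v x"
    by (auto simp: vclosure_def)
  have "(adj V W B)\<^sup>*\<^sup>* x u" "(adj V W B)\<^sup>*\<^sup>* x v"
    using x symp_rtranclp[OF symp_adj] by (auto dest: sympD)
  with x show "vclosure V W B {u} = vclosure V W B {v}"
    by (auto simp: vclosure_def intro: rtranclp_trans)
qed

lemma vclosure_mono:
  assumes "V \<subseteq> V'" "W \<subseteq> W'"
  shows "vclosure V W B T \<subseteq> vclosure V' W' B T"
proof -
  have "(adj V W B)\<^sup>*\<^sup>* \<le> (adj V' W' B)\<^sup>*\<^sup>*"
    using assms by (intro rtranclp_mono) (unfold adj_def le_fun_def le_bool_def, blast)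
  then show ?thesis by (auto simp: vclosure_def)
qed

text \<open>The event is split by edges: \<open>closed_pair\<close> reads only edges between
  \<open>(A, L)\<close> and the rest, the closure conditions on the right only edges inside
  \<open>A \<times> L\<close>. Disjointness of these edge sets gives independence below.\<close>

lemma vclosure_aclosure_eq_iff:
  assumes A: "A \<subseteq> V" and L: "L \<subseteq> W"
  shows "vclosure V W B T = A \<and> aclosure V W B T = L \<longleftrightarrow>
    closed_pair V W A L B \<and> T \<subseteq> A \<and> vclosure A L B T = A \<and> aclosure A L B T = L"
    (is "?lhs \<longleftrightarrow> ?rhs")
proof
  assume ?lhs
  then have V: "vclosure V W B T = A" and W: "aclosure V W B T = L" by auto
  have TA: "T \<subseteq> A" using V subset_vclosure by blast
  have AL: "k \<in> L" if "i \<in> A" "k \<in> W" "B (i, k)" for i k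
    using that V W by (auto simp: aclosure_def)
  have LA: "i \<in> A" if "i \<in> V" "k \<in> L" "B (i, k)" for i k
  proof -
    obtain j where j: "j \<in> vclosure V W B T" "B (j, k)" "k \<in> W"
      using \<open>k \<in> L\<close> W by (auto simp: aclosure_def)
    then obtain v where v: "v \<in> T" "(adj V W B)\<^sup>*\<^sup>* v j" by (auto simp: vclosure_def)
    have "adj V W B j i" using j that V A by (auto simp: adj_def)
    with v have "(adj V W B)\<^sup>*\<^sup>* v i" by (meson rtranclp.rtrancl_into_rtrancl)
    with v V show ?thesis by (auto simp: vclosure_def)
  qed
  have cl: "closed_pair V W A L B"
    using AL LA by (auto simp: closed_pair_def)
  \<comment> \<open>A path from \<open>T\<close> stays in \<open>A\<close>, and each auxiliary
    vertex it uses has a neighbour in \<open>A\<close>, hence lies in \<open>L\<close>; so the path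
    survives the restriction.\<close>
  have path: "(adj A L B)\<^sup>*\<^sup>* v u" if "(adj V W B)\<^sup>*\<^sup>* v u" "v \<in> T" for u v
    using that
  proof (induction rule: rtranclp_induct)
    case (step y z)
    then have "y \<in> A" using V by (auto simp: vclosure_def)
    then have "adj A L B y z" using step(2) AL LA by (auto simp: adj_def)
    with step show ?case by (meson rtranclp.rtrancl_into_rtrancl)
  qed auto
  have VA: "vclosure A L B T = A"
  proof (rule antisym[OF vclosure_subset[OF TA]])
    have "vclosure V W B T \<subseteq> vclosure A L B T" using path unfolding vclosure_def by blast
    then show "A \<subseteq> vclosure A L B T" using V by simp
  qed
  then have "aclosure A L B T = L"
    using W V L by (auto simp: aclosure_def)
  with cl TA VA show ?rhs by auto
next
  assume ?rhs
  then have cl: "closed_pair V W A L B" and T: "T \<subseteq> A"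
    and V: "vclosure A L B T = A" and W: "aclosure A L B T = L" by auto
  have "u \<in> A" if "(adj V W B)\<^sup>*\<^sup>* v u" "v \<in> A" for u v
    using that
    by (induction rule: rtranclp_induct) (use cl in \<open>auto simp: adj_def closed_pair_def\<close>)
  then have "vclosure V W B T \<subseteq> A" using T by (auto simp: vclosure_def)
  moreover have "A \<subseteq> vclosure V W B T" using vclosure_mono[OF A L, of B T] V by auto
  ultimately have VA: "vclosure V W B T = A" by auto
  moreover have "aclosure V W B T = L"
  proof (intro equalityI subsetI)
    fix k assume "k \<in> aclosure V W B T"
    then show "k \<in> L" using cl VA by (auto simp: aclosure_def closed_pair_def)
  next
    fix k assume "k \<in> L"
    then have "k \<in> aclosure A L B T" using W by simp
    then show "k \<in> aclosure V W B T" using V L unfolding aclosure_def VA by auto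
  qed
  ultimately show ?lhs by auto
qed

text \<open>Invariance under relabelling. It reduces general \<open>A\<close> and \<open>L\<close>
  to initial segments; with identity maps it shows that closures depend only on \<open>B\<close>
  inside \<open>A \<times> L\<close>.\<close>

lemma rtranclp_adj_image:
  assumes f: "inj_on f A" and g: "inj_on g L"
    and B: "\<And>i k. i \<in> A \<Longrightarrow> k \<in> L \<Longrightarrow> B' (i, k) = B (f i, g k)" and v: "v \<in> A"
  shows "(adj (f ` A) (g ` L) B)\<^sup>*\<^sup>* (f v) x \<longleftrightarrow> (\<exists>u. x = f u \<and> (adj A L B')\<^sup>*\<^sup>* v u)"
proof
  assume "(adj (f ` A) (g ` L) B)\<^sup>*\<^sup>* (f v) x"
  then show "\<exists>u. x = f u \<and> (adj A L B')\<^sup>*\<^sup>* v u"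
  proof (induction rule: rtranclp_induct)
    case (step y z)
    then obtain u where u: "y = f u" "(adj A L B')\<^sup>*\<^sup>* v u" by auto
    then have "u \<in> A" using v adj_rtranclp_mem by metis
    obtain w where w: "w \<in> A" "z = f w" using step(2) by (auto simp: adj_def)
    have "adj A L B' u w"
      using step(2) u(1) w \<open>u \<in> A\<close> B by (auto simp: adj_def)
    with u w show ?case by (metis rtranclp.rtrancl_into_rtrancl)
  qed auto
next
  assume "\<exists>u. x = f u \<and> (adj A L B')\<^sup>*\<^sup>* v u"
  then obtain u where u: "x = f u" "(adj A L B')\<^sup>*\<^sup>* v u" by auto
  from u(2) have "(adj (f ` A) (g ` L) B)\<^sup>*\<^sup>* (f v) (f u)"
  proof (induction rule: rtranclp_induct)
    case (step y z)
    have "adj (f ` A) (g ` L) B (f y) (f z)"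
      using step(2) B by (auto simp: adj_def)
    with step show ?case by (meson rtranclp.rtrancl_into_rtrancl)
  qed auto
  with u show "(adj (f ` A) (g ` L) B)\<^sup>*\<^sup>* (f v) x" by simp
qed

lemma vclosure_image:
  assumes "inj_on f A" "inj_on g L"
    and "\<And>i k. i \<in> A \<Longrightarrow> k \<in> L \<Longrightarrow> B' (i, k) = B (f i, g k)" and "T \<subseteq> A"
  shows "vclosure (f ` A) (g ` L) B (f ` T) = f ` vclosure A L B' T"
  using rtranclp_adj_image[OF assms(1,2), of B' B] assms(3,4) by (fastforce simp: vclosure_def)

lemma aclosure_image:
  assumes f: "inj_on f A" and g: "inj_on g L"
    and B: "\<And>i k. i \<in> A \<Longrightarrow> k \<in> L \<Longrightarrow> B' (i, k) = B (f i, g k)" and T: "T \<subseteq> A"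
  shows "aclosure (f ` A) (g ` L) B (f ` T) = g ` aclosure A L B' T"
proof -
  have "vclosure (f ` A) (g ` L) B (f ` T) = f ` vclosure A L B' T"
    using assms by (rule vclosure_image)
  moreover have "B' (i, k) = B (f i, g k)" if "i \<in> vclosure A L B' T" "k \<in> L" for i k
    using that B vclosure_subset[OF T] by blast
  ultimately show ?thesis by (auto simp: aclosure_def image_iff) blast
qed

section \<open>Independence of disjoint edge sets\<close>

definition edge_pmf :: "real \<Rightarrow> (nat \<times> nat) set \<Rightarrow> (nat \<times> nat \<Rightarrow> bool) pmf" where
  "edge_pmf p E = Pi_pmf E False (\<lambda>_. bernoulli_pmf p)"

lemma prob_no_edges:
  assumes "finite E" "Z \<subseteq> E" "0 \<le> p" "p \<le> 1"
  shows "measure_pmf.prob (edge_pmf p E) {B. \<forall>z\<in>Z. \<not> B z} = (1 - p) ^ card Z"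
proof -
  have "{B. \<forall>z\<in>Z. \<not> B z} = Pi E (\<lambda>z. if z \<in> Z then {False} else UNIV)"
    using assms by (auto simp: Pi_def)
  then have "measure_pmf.prob (edge_pmf p E) {B. \<forall>z\<in>Z. \<not> B z} =
      (\<Prod>z\<in>E. measure_pmf.prob (bernoulli_pmf p) (if z \<in> Z then {False} else UNIV))"
    unfolding edge_pmf_def using assms by (simp add: measure_Pi_pmf_Pi)
  also have "\<dots> = (\<Prod>z\<in>E. if z \<in> Z then 1 - p else 1)"
    using assms by (intro prod.cong) (auto simp: measure_pmf_single)
  also have "\<dots> = (1 - p) ^ card Z"
    using assms by (simp add: prod.If_cases Int_absorb1)
  finally show ?thesis .
qed

lemma prob_pair_pmf_times:
  "measure_pmf.prob (pair_pmf M N) (X \<times> Y) = measure_pmf.prob M X * measure_pmf.prob N Y"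
proof -
  \<comment> \<open>Intersecting with the supports makes both factors countable, as the product rule
    requires.\<close>
  have "measure_pmf.prob (pair_pmf M N) (X \<times> Y) =
      measure_pmf.prob (pair_pmf M N) ((X \<inter> set_pmf M) \<times> (Y \<inter> set_pmf N))"
    by (rule measure_prob_cong_0) (auto simp: pmf_eq_0_set_pmf)
  also have "\<dots> = measure_pmf.prob M (X \<inter> set_pmf M) * measure_pmf.prob N (Y \<inter> set_pmf N)"
    by (rule measure_pmf_prob_product) auto
  finally show ?thesis by (simp add: measure_Int_set_pmf)
qed

text \<open>The configuration on \<open>E\<close> is glued by \<open>h\<close> from independent ones
  on \<open>F\<close> and \<open>E - F\<close>. Since \<open>P\<close> reads only \<open>F\<close>
  and \<open>Z\<close> avoids \<open>F\<close>, the preimage of the event under \<open>h\<close> is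
  a rectangle.\<close>

lemma prob_edge_pmf_indep:
  assumes fin: "finite E" and F: "F \<subseteq> E" and Z: "Z \<subseteq> E - F" and p: "0 \<le> p" "p \<le> 1"
    and cong: "\<And>B B'. (\<And>z. z \<in> F \<Longrightarrow> B z = B' z) \<Longrightarrow> P B = P B'"
  shows "measure_pmf.prob (edge_pmf p E) {B. (\<forall>z\<in>Z. \<not> B z) \<and> P B} =
    measure_pmf.prob (edge_pmf p F) {B. P B} * (1 - p) ^ card Z"
proof -
  have finF: "finite F" using fin F finite_subset by auto
  have E: "E = F \<union> (E - F)" using F by auto
  define h :: "(nat \<times> nat \<Rightarrow> bool) \<times> (nat \<times> nat \<Rightarrow> bool) \<Rightarrow> nat \<times> nat \<Rightarrow> bool"
    where "h = (\<lambda>(f, g) x. if x \<in> F then f x else g x)"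
  have "edge_pmf p E = map_pmf h (pair_pmf (edge_pmf p F) (edge_pmf p (E - F)))"
    unfolding edge_pmf_def h_def by (subst E, rule Pi_pmf_union) (use fin finF in auto)
  then have "measure_pmf.prob (edge_pmf p E) {B. (\<forall>z\<in>Z. \<not> B z) \<and> P B} =
      measure_pmf.prob (pair_pmf (edge_pmf p F) (edge_pmf p (E - F)))
        (h -` {B. (\<forall>z\<in>Z. \<not> B z) \<and> P B})"
    by simp
  also have "h -` {B. (\<forall>z\<in>Z. \<not> B z) \<and> P B} = {B. P B} \<times> {B. \<forall>z\<in>Z. \<not> B z}"
  proof -
    have "P (h (f, g)) = P f" for f g
      by (rule cong) (auto simp: h_def)
    moreover have "(\<forall>z\<in>Z. \<not> h (f, g) z) \<longleftrightarrow> (\<forall>z\<in>Z. \<not> g z)" for f g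
      using Z by (auto simp: h_def)
    ultimately show ?thesis by (auto simp del: ball_simps) blast+
  qed
  also have "measure_pmf.prob (pair_pmf (edge_pmf p F) (edge_pmf p (E - F))) \<dots> =
      measure_pmf.prob (edge_pmf p F) {B. P B} * (1 - p) ^ card Z"
    using prob_no_edges[of "E - F" Z p] fin Z p by (simp add: prob_pair_pmf_times)
  finally show ?thesis .
qed

subsection \<open>Counting tuples by the size of their components\<close>

text \<open>Repetitions are allowed: a set of size \<open>n\<close> has exactly \<open>n ^ r\<close>
  tuples, and a single vertex can be viewed as the pair \<open>[v, v]\<close>.\<close>

definition tuples :: "nat \<Rightarrow> nat set \<Rightarrow> nat list set" where
  "tuples r V = {xs. set xs \<subseteq> V \<and> length xs = r}"

lemma finite_tuples: "finite V \<Longrightarrow> finite (tuples r V)"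
  unfolding tuples_def by (rule finite_lists_length_eq)

lemma card_tuples: "finite V \<Longrightarrow> card (tuples r V) = card V ^ r"
  unfolding tuples_def by (rule card_lists_length_eq)

lemma tuples_image: "tuples r (f ` A) = map f ` tuples r A"
proof (intro equalityI subsetI)
  fix xs assume "xs \<in> tuples r (f ` A)"
  then have xs: "set xs \<subseteq> f ` A" "length xs = r" by (auto simp: tuples_def)
  define ys where "ys = map (inv_into A f) xs"
  have "map f ys = xs"
    unfolding ys_def map_map by (rule map_idI) (use xs in \<open>auto simp: f_inv_into_f\<close>)
  moreover have "ys \<in> tuples r A"
    using xs by (auto simp: ys_def tuples_def intro!: inv_into_into)
  ultimately show "xs \<in> map f ` tuples r A" by blast
qed (fastforce simp: tuples_def)

definition cover_prob :: "real \<Rightarrow> nat set \<Rightarrow> nat set \<Rightarrow> nat set \<Rightarrow> real" where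
  "cover_prob p A L T =
    measure_pmf.prob (edge_pmf p (A \<times> L)) {B. vclosure A L B T = A \<and> aclosure A L B T = L}"

text \<open>The factor of the expected tuple counts that does not depend on the numbers of vertices
  of the ambient graph.\<close>
definition cover_sum :: "real \<Rightarrow> nat \<Rightarrow> nat \<Rightarrow> nat \<Rightarrow> real" where
  "cover_sum p r k l = (\<Sum>xs\<in>tuples r {..<k}. cover_prob p {..<k} {..<l} (set xs))"

lemma vclosure_aclosure_cong:
  assumes "\<And>z. z \<in> A \<times> L \<Longrightarrow> B z = B' z" "T \<subseteq> A"
  shows "vclosure A L B T = vclosure A L B' T" "aclosure A L B T = aclosure A L B' T"
  using vclosure_image[of id A id L B' B T] aclosure_image[of id A id L B' B T] assms by auto

text \<open>The exponent counts the possible edges between \<open>(A, L)\<close> and the rest, which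
  form two disjoint rectangles; their absence is independent of the edges inside.\<close>

lemma prob_vclosure_aclosure_eq:
  assumes fin: "finite V" "finite W" and A: "A \<subseteq> V" and L: "L \<subseteq> W"
    and T: "T \<subseteq> A" and p: "0 \<le> p" "p \<le> 1"
  shows "measure_pmf.prob (edge_pmf p (V \<times> W)) {B. vclosure V W B T = A \<and> aclosure V W B T = L} =
    cover_prob p A L T * (1 - p) ^ (card A * (card W - card L) + (card V - card A) * card L)"
proof -
  let ?Z = "A \<times> (W - L) \<union> (V - A) \<times> L"
  have finAL: "finite A" "finite L" using A L fin finite_subset by auto
  have "{B. vclosure V W B T = A \<and> aclosure V W B T = L} =
      {B. (\<forall>z\<in>?Z. \<not> B z) \<and> (vclosure A L B T = A \<and> aclosure A L B T = L)}"
    using vclosure_aclosure_eq_iff[OF A L] T by (auto simp: closed_pair_def)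
  moreover have "measure_pmf.prob (edge_pmf p (V \<times> W))
      {B. (\<forall>z\<in>?Z. \<not> B z) \<and> (vclosure A L B T = A \<and> aclosure A L B T = L)} =
      cover_prob p A L T * (1 - p) ^ card ?Z"
    unfolding cover_prob_def
  proof (rule prob_edge_pmf_indep)
    fix B B' :: "nat \<times> nat \<Rightarrow> bool"
    assume "\<And>z. z \<in> A \<times> L \<Longrightarrow> B z = B' z"
    then show "(vclosure A L B T = A \<and> aclosure A L B T = L) = (vclosure A L B' T = A \<and> aclosure A L B' T = L)"
      using vclosure_aclosure_cong[of A L B B' T] T by simp
  qed (use A L fin p in auto)
  moreover have "card ?Z = card A * (card W - card L) + (card V - card A) * card L"
    using fin finAL A L
    by (subst card_Un_disjoint) (auto simp: card_cartesian_product card_Diff_subset)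
  ultimately show ?thesis by simp
qed

text \<open>Composing a configuration with the relabelling must return the default
  \<open>False\<close> outside the new index set, so points outside \<open>{..<k}\<close> have to be
  sent outside \<open>A\<close>.\<close>

lemma ex_bij_complement:
  assumes "finite A" "card A = k"
  shows "\<exists>f::nat \<Rightarrow> nat. bij_betw f {..<k} A \<and> (\<forall>x. x \<notin> {..<k} \<longrightarrow> f x \<notin> A)"
proof -
  obtain f where f: "bij_betw f {..<k} A"
    using assms ex_bij_betw_nat_finite[of A] by (auto simp: atLeast0LessThan)
  obtain a where a: "a \<notin> A" using ex_new_if_finite[OF infinite_UNIV_nat assms(1)] by auto
  have "bij_betw (\<lambda>x. if x < k then f x else a) {..<k} A"
    using f by (subst bij_betw_cong[where g = f]) auto
  then show ?thesis using a by (intro exI[of _ "\<lambda>x. if x < k then f x else a"]) auto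
qed

text \<open>Relabelling carries edge distributions to edge distributions and tuples to tuples. A
  single summand also depends on the number of distinct entries of the tuple; only the sum is a
  function of the two sizes.\<close>

lemma sum_cover_prob:
  assumes "finite A" "finite L"
  shows "(\<Sum>xs\<in>tuples r A. cover_prob p A L (set xs)) = cover_sum p r (card A) (card L)"
proof -
  define k l where "k = card A" and "l = card L"
  obtain f where f: "bij_betw f {..<k} A" "\<And>x. x \<notin> {..<k} \<Longrightarrow> f x \<notin> A"
    using ex_bij_complement[OF assms(1)] k_def by metis
  obtain g where g: "bij_betw g {..<l} L" "\<And>x. x \<notin> {..<l} \<Longrightarrow> g x \<notin> L"
    using ex_bij_complement[OF assms(2)] l_def by metis
  have inj: "inj_on f {..<k}" "inj_on g {..<l}" and img: "f ` {..<k} = A" "g ` {..<l} = L"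
    using f g by (auto simp: bij_betw_def)
  define h where "h = (\<lambda>(i, k). (f i, g k))"
  have h: "edge_pmf p ({..<k} \<times> {..<l}) = map_pmf (\<lambda>B. B \<circ> h) (edge_pmf p (A \<times> L))"
    unfolding edge_pmf_def
  proof (rule Pi_pmf_bij_betw)
    show "bij_betw h ({..<k} \<times> {..<l}) (A \<times> L)"
      using inj img by (auto simp: bij_betw_def h_def inj_on_def)
    show "h x \<notin> A \<times> L" if "x \<notin> {..<k} \<times> {..<l}" for x
      using that f(2) g(2) by (cases x) (auto simp: h_def)
  qed auto
  have cp: "cover_prob p A L (f ` T) = cover_prob p {..<k} {..<l} T" if T: "T \<subseteq> {..<k}" for T
  proof -
    have "vclosure A L B (f ` T) = A \<and> aclosure A L B (f ` T) = L \<longleftrightarrow>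
        vclosure {..<k} {..<l} (B \<circ> h) T = {..<k} \<and> aclosure {..<k} {..<l} (B \<circ> h) T = {..<l}" for B
    proof -
      have V: "vclosure A L B (f ` T) = f ` vclosure {..<k} {..<l} (B \<circ> h) T"
        using vclosure_image[OF inj, of "B \<circ> h" B T] T by (simp add: h_def img)
      have W: "aclosure A L B (f ` T) = g ` aclosure {..<k} {..<l} (B \<circ> h) T"
        using aclosure_image[OF inj, of "B \<circ> h" B T] T by (simp add: h_def img)
      have "f ` vclosure {..<k} {..<l} (B \<circ> h) T = f ` {..<k} \<longleftrightarrow> vclosure {..<k} {..<l} (B \<circ> h) T = {..<k}"
        by (rule inj_on_image_eq_iff[OF inj(1)]) (use vclosure_subset[OF T] in auto)
      moreover have "g ` aclosure {..<k} {..<l} (B \<circ> h) T = g ` {..<l} \<longleftrightarrow>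
          aclosure {..<k} {..<l} (B \<circ> h) T = {..<l}"
        by (rule inj_on_image_eq_iff[OF inj(2)]) (use aclosure_subset in auto)
      ultimately show ?thesis using V W img by metis
    qed
    then show ?thesis
      unfolding cover_prob_def h by (simp add: vimage_def)
  qed
  have "(\<Sum>xs\<in>tuples r A. cover_prob p A L (set xs)) =
      (\<Sum>xs\<in>map f ` tuples r {..<k}. cover_prob p A L (set xs))"
    by (simp add: img(1) flip: tuples_image)
  also have "\<dots> = (\<Sum>xs\<in>tuples r {..<k}. cover_prob p A L (set (map f xs)))"
  proof (rule sum.reindex[unfolded comp_def])
    show "inj_on (map f) (tuples r {..<k})"
      by (rule inj_onI, rule map_inj_on[of f]) (use inj(1) in \<open>auto simp: tuples_def elim!: inj_on_subset\<close>)
  qed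
  also have "\<dots> = (\<Sum>xs\<in>tuples r {..<k}. cover_prob p {..<k} {..<l} (set xs))"
    by (intro sum.cong refl) (auto simp: tuples_def cp)
  finally show ?thesis by (simp add: cover_sum_def k_def l_def)
qed

text \<open>An expected number of tuples, written as a sum of probabilities by linearity.\<close>

definition tuple_count :: "real \<Rightarrow> nat \<Rightarrow> nat \<Rightarrow> nat \<Rightarrow> nat \<Rightarrow> nat \<Rightarrow> real" where
  "tuple_count p n m r k l = (\<Sum>xs\<in>tuples r {..<n}. measure_pmf.prob (bip_pmf n m p)
    {B. card (vclosure {..<n} {..<m} B (set xs)) = k \<and> card (aclosure {..<n} {..<m} B (set xs)) = l})"

lemma tuple_count_nonneg: "0 \<le> tuple_count p n m r k l"
  by (simp add: tuple_count_def sum_nonneg)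

text \<open>The event is split by the values \<open>A\<close> and \<open>L\<close> of the two
  closures: the binomials count them, the power is the cost of separation, and
  \<open>cover_sum\<close> is what happens inside. If \<open>k > n\<close> or \<open>l > m\<close>,
  a binomial vanishes, so truncated subtraction does no harm.\<close>

lemma tuple_count_eq:
  assumes p: "0 \<le> p" "p \<le> 1"
  shows "tuple_count p n m r k l = real (n choose k) * real (m choose l) *
    (1 - p) ^ (k * (m - l) + (n - k) * l) * cover_sum p r k l"
proof -
  let ?V = "{..<n}" and ?W = "{..<m}"
  let ?KV = "{A. A \<subseteq> ?V \<and> card A = k}" and ?KW = "{L. L \<subseteq> ?W \<and> card L = l}"
  let ?q = "(1 - p) ^ (k * (m - l) + (n - k) * l)"
  let ?E = "\<lambda>xs A L. {B. vclosure ?V ?W B (set xs) = A \<and> aclosure ?V ?W B (set xs) = L}"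
  let ?P = "measure_pmf.prob (bip_pmf n m p)"
  have bip: "bip_pmf n m p = edge_pmf p (?V \<times> ?W)"
    by (simp add: bip_pmf_def edge_pmf_def)
  have fin: "finite ?KV" "finite ?KW" by auto
  have split: "?P {B. card (vclosure ?V ?W B (set xs)) = k \<and> card (aclosure ?V ?W B (set xs)) = l} =
      (\<Sum>z\<in>?KV \<times> ?KW. ?P (?E xs (fst z) (snd z)))" if xs: "xs \<in> tuples r ?V" for xs
  proof -
    have "vclosure ?V ?W B (set xs) \<subseteq> ?V" for B
      by (rule vclosure_subset) (use xs in \<open>auto simp: tuples_def\<close>)
    then have eq: "{B. card (vclosure ?V ?W B (set xs)) = k \<and> card (aclosure ?V ?W B (set xs)) = l} =
        (\<Union>z\<in>?KV \<times> ?KW. ?E xs (fst z) (snd z))"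
      using aclosure_subset[of ?V ?W] by auto
    show ?thesis unfolding eq
    proof (rule measure_pmf.finite_measure_finite_Union)
      show "disjoint_family_on (\<lambda>z. ?E xs (fst z) (snd z)) (?KV \<times> ?KW)"
        unfolding disjoint_family_on_def
      proof (intro ballI impI)
        fix y z assume "y \<in> ?KV \<times> ?KW" "z \<in> ?KV \<times> ?KW" "y \<noteq> z"
        then have "fst y \<noteq> fst z \<or> snd y \<noteq> snd z" by (simp add: prod_eq_iff)
        then show "?E xs (fst y) (snd y) \<inter> ?E xs (fst z) (snd z) = {}" by blast
      qed
      show "finite (?KV \<times> ?KW)" using fin by (rule finite_cartesian_product)
    qed (simp only: sets_measure_pmf subset_UNIV)
  qed
  have inner: "(\<Sum>xs\<in>tuples r ?V. ?P (?E xs A L)) = ?q * cover_sum p r k l"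
    if AL: "A \<in> ?KV" "L \<in> ?KW" for A L
  proof -
    have fAL: "finite A" "finite L" using AL by (auto intro: finite_subset)
    \<comment> \<open>A tuple lies in its own closure, so tuples leaving \<open>A\<close> contribute
      nothing.\<close>
    have "(\<Sum>xs\<in>tuples r ?V. ?P (?E xs A L)) = (\<Sum>xs\<in>tuples r A. ?P (?E xs A L))"
    proof (rule sum.mono_neutral_right)
      show "\<forall>xs\<in>tuples r ?V - tuples r A. ?P (?E xs A L) = 0"
      proof
        fix xs assume "xs \<in> tuples r ?V - tuples r A"
        then have "\<not> set xs \<subseteq> A" by (auto simp: tuples_def)
        then have "?E xs A L = {}" using subset_vclosure by blast
        then show "?P (?E xs A L) = 0" by (metis measure_empty)
      qed
    qed (use AL in \<open>auto simp: tuples_def intro: finite_tuples[unfolded tuples_def]\<close>)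
    also have "\<dots> = (\<Sum>xs\<in>tuples r A. cover_prob p A L (set xs) * ?q)"
    proof (rule sum.cong)
      fix xs assume "xs \<in> tuples r A"
      then show "?P (?E xs A L) = cover_prob p A L (set xs) * ?q"
        unfolding bip using prob_vclosure_aclosure_eq[of ?V ?W A L "set xs" p] AL p by (auto simp: tuples_def)
    qed simp
    also have "\<dots> = ?q * cover_sum p r k l"
      using sum_cover_prob[OF fAL, of p r] AL by (simp add: mult.commute flip: sum_distrib_right)
    finally show ?thesis .
  qed
  have "tuple_count p n m r k l =
      (\<Sum>xs\<in>tuples r ?V. \<Sum>z\<in>?KV \<times> ?KW. ?P (?E xs (fst z) (snd z)))"
    unfolding tuple_count_def by (intro sum.cong refl split)
  also have "\<dots> = (\<Sum>z\<in>?KV \<times> ?KW. \<Sum>xs\<in>tuples r ?V. ?P (?E xs (fst z) (snd z)))"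
    by (rule sum.swap)
  also have "\<dots> = (\<Sum>z\<in>?KV \<times> ?KW. ?q * cover_sum p r k l)"
    by (intro sum.cong refl inner) (simp_all add: mem_Times_iff)
  also have "\<dots> = real (n choose k) * real (m choose l) * ?q * cover_sum p r k l"
    by (simp add: card_cartesian_product n_subsets)
  finally show ?thesis .
qed

lemma sum_tuple_count:
  assumes "finite S"
  shows "(\<Sum>(k, l)\<in>S. tuple_count p n m r k l) = (\<Sum>xs\<in>tuples r {..<n}.
    measure_pmf.prob (bip_pmf n m p)
      {B. (card (vclosure {..<n} {..<m} B (set xs)), card (aclosure {..<n} {..<m} B (set xs))) \<in> S})"
proof -
  let ?P = "measure_pmf.prob (bip_pmf n m p)"
  let ?c = "\<lambda>B xs. (card (vclosure {..<n} {..<m} B (set xs)), card (aclosure {..<n} {..<m} B (set xs)))"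
  have "(\<Sum>(k, l)\<in>S. tuple_count p n m r k l) =
      (\<Sum>z\<in>S. \<Sum>xs\<in>tuples r {..<n}. ?P {B. ?c B xs = z})"
    by (intro sum.cong refl) (auto simp: tuple_count_def)
  also have "\<dots> = (\<Sum>xs\<in>tuples r {..<n}. \<Sum>z\<in>S. ?P {B. ?c B xs = z})"
    by (rule sum.swap)
  also have "\<dots> = (\<Sum>xs\<in>tuples r {..<n}. ?P (\<Union>z\<in>S. {B. ?c B xs = z}))"
    by (intro sum.cong refl measure_pmf.finite_measure_finite_Union[symmetric])
      (use assms in \<open>auto simp: disjoint_family_on_def\<close>)
  also have "\<dots> = (\<Sum>xs\<in>tuples r {..<n}. ?P {B. ?c B xs \<in> S})"
    by (intro sum.cong refl arg_cong[of _ _ ?P]) auto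
  finally show ?thesis .
qed

text \<open>The events for different size pairs are disjoint, so each tuple contributes at most 1.
  Applied to graphs of other sizes, this trivial count is the source of all the probability bounds
  below.\<close>

lemma sum_tuple_count_le:
  assumes "finite S"
  shows "(\<Sum>(k, l)\<in>S. tuple_count p n m r k l) \<le> real n ^ r"
proof -
  have "(\<Sum>(k, l)\<in>S. tuple_count p n m r k l) \<le> (\<Sum>xs\<in>tuples r {..<n}. 1)"
    unfolding sum_tuple_count[OF assms] by (intro sum_mono) auto
  then show ?thesis by (simp add: card_tuples)
qed

lemma tuple_count_le: "tuple_count p n m r k l \<le> real n ^ r"
  using sum_tuple_count_le[of "{(k, l)}"] by simp

subsection \<open>Changing the number of vertices\<close>

text \<open>Resizing one side of the bipartite graph from \<open>N'\<close> to \<open>N\<close> multiplies the expected tuple counts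
  by this factor; \<open>w\<close> is the probability that a vertex of that side outside the components
  has no edge into them.\<close>
definition ratio :: "nat \<Rightarrow> nat \<Rightarrow> nat \<Rightarrow> real \<Rightarrow> real" where
  "ratio N N' K w = real (N choose K) * w ^ (N - K) / (real (N' choose K) * w ^ (N' - K))"

lemma ratio_nonneg: "0 \<le> w \<Longrightarrow> 0 \<le> ratio N N' K w"
  by (simp add: ratio_def)

lemma ratio_same: "K \<le> N \<Longrightarrow> 0 < w \<Longrightarrow> ratio N N K w = 1"
  by (simp add: ratio_def)

text \<open>In the quotient \<open>cover_sum\<close> cancels, and the exponent splits into a part
  depending on \<open>n\<close> and a part depending on \<open>m\<close>; so the two sides can be
  resized separately.\<close>

lemma tuple_count_transfer:
  assumes p: "0 < p" "p < 1" and "k \<le> n'" "l \<le> m'"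
  shows "tuple_count p n m r k l =
    ratio n n' k ((1 - p) ^ l) * ratio m m' l ((1 - p) ^ k) * tuple_count p n' m' r k l"
proof -
  have "(1 - p) ^ (k * (M - l) + (N - k) * l) = ((1 - p) ^ k) ^ (M - l) * ((1 - p) ^ l) ^ (N - k)"
    for M N
    by (simp add: power_add mult.commute flip: power_mult)
  moreover have "real (n' choose k) > 0" "real (m' choose l) > 0"
    using assms by auto
  ultimately show ?thesis
    using p by (simp add: tuple_count_eq ratio_def)
qed

lemma choose_Suc_mult:
  assumes "K \<le> N"
  shows "real (Suc N choose K) * (real (Suc N) - real K) = real (Suc N) * real (N choose K)"
proof -
  have "(Suc N - K) * (Suc N choose K) = Suc N * (N choose K)"
    using binomial_absorb_comp[of "Suc N" K] by simp
  then have "real (Suc N - K) * real (Suc N choose K) = real (Suc N) * real (N choose K)"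
    by (metis of_nat_mult)
  moreover have "real (Suc N - K) = real (Suc N) - real K"
    using assms by (intro of_nat_diff) simp
  ultimately show ?thesis by (metis mult.commute)
qed

text \<open>Going from size \<open>M\<close> to \<open>M + 1\<close> multiplies the ratio by
  \<open>(1 - K / (M + 1)) / w\<close>, and \<open>c\<close> bounds each of these factors.\<close>

lemma ratio_up:
  assumes "K \<le> N" "0 < w" and c: "\<And>j. 1 \<le> j \<Longrightarrow> j \<le> a \<Longrightarrow> 1 - real K / real (N + j) \<le> c * w"
  shows "ratio N (N + a) K w \<le> c ^ a"
  using c
proof (induction a)
  case 0
  then show ?case using assms by (simp add: ratio_same)
next
  case (Suc a)
  let ?M = "N + a"
  have "real (Suc ?M choose K) = real (Suc ?M) * real (?M choose K) / (real (Suc ?M) - real K)"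
    using choose_Suc_mult[of K ?M] assms by (simp add: field_simps)
  then have "ratio N (N + Suc a) K w =
      ratio N ?M K w * ((real (Suc ?M) - real K) / (real (Suc ?M) * w))"
    using assms by (simp add: ratio_def Suc_diff_le mult_ac)
  also have "\<dots> \<le> c ^ a * c"
  proof (rule mult_mono)
    have "(real (Suc ?M) - real K) / (real (Suc ?M) * w) = (1 - real K / real (Suc ?M)) / w"
      by (simp add: divide_simps)
    also have "\<dots> \<le> c"
      using Suc.prems[of "Suc a"] assms by (simp add: pos_divide_le_eq)
    finally show "(real (Suc ?M) - real K) / (real (Suc ?M) * w) \<le> c" .
    show "ratio N ?M K w \<le> c ^ a" using Suc by auto
    then show "0 \<le> c ^ a" using ratio_nonneg[of w N ?M K] assms by linarith
    show "0 \<le> (real (Suc ?M) - real K) / (real (Suc ?M) * w)"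
      using assms by (intro divide_nonneg_nonneg) auto
  qed
  finally show ?case by (simp add: mult.commute)
qed

text \<open>Here \<open>N\<close> is the smaller size, and the factors are the reciprocals of those
  in \<open>ratio_up\<close>.\<close>

lemma ratio_down:
  assumes "K \<le> N" "0 < w" "0 \<le> c"
    and c: "\<And>j. 1 \<le> j \<Longrightarrow> j \<le> a \<Longrightarrow> w \<le> c * (1 - real K / real (N + j))"
  shows "ratio (N + a) N K w \<le> c ^ a"
  using c
proof (induction a)
  case 0
  then show ?case using assms by (simp add: ratio_same)
next
  case (Suc a)
  let ?M = "N + a"
  have pos: "real (Suc ?M) - real K > 0" using assms by simp
  then have "real (Suc ?M choose K) = real (Suc ?M) * real (?M choose K) / (real (Suc ?M) - real K)"
    using choose_Suc_mult[of K ?M] assms by (simp add: field_simps)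
  then have "ratio (N + Suc a) N K w =
      ratio ?M N K w * (real (Suc ?M) * w / (real (Suc ?M) - real K))"
    using assms by (simp add: ratio_def Suc_diff_le mult_ac)
  also have "\<dots> \<le> c ^ a * c"
  proof (rule mult_mono)
    have "w \<le> c * (1 - real K / real (Suc ?M))"
      using Suc.prems[of "Suc a"] by simp
    then have "real (Suc ?M) * w \<le> real (Suc ?M) * (c * (1 - real K / real (Suc ?M)))"
      by (intro mult_left_mono) auto
    also have "\<dots> = c * (real (Suc ?M) - real K)"
      by (simp add: field_simps)
    finally show "real (Suc ?M) * w / (real (Suc ?M) - real K) \<le> c"
      using pos by (simp add: pos_divide_le_eq)
    show "ratio ?M N K w \<le> c ^ a" using Suc by auto
    show "0 \<le> c ^ a" using assms by simp
    show "0 \<le> real (Suc ?M) * w / (real (Suc ?M) - real K)"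
      using assms pos by (intro divide_nonneg_nonneg) auto
  qed
  finally show ?case by (simp add: mult.commute)
qed

text \<open>If \<open>w\<close> exceeds \<open>1 - K / N\<close>, vertices are added; in the
  opposite case they are removed. Each of the \<open>a\<close> changes gains a factor
  \<open>exp (- s / 4)\<close>. The size varies only by a proportion \<open>x\<close>, and
  \<open>4 * x * (K / N) \<le> s\<close> prevents the drift of \<open>K / N'\<close> from using up
  the gap.\<close>

lemma ratio_decay:
  assumes K: "K \<le> N" and w: "0 < w" "w \<le> 1" and N: "0 < N"
    and x: "0 \<le> x" "x \<le> 1/2" "real a \<le> x * real N"
    and s: "0 \<le> s" "4 * x * (real K / real N) \<le> s"
    and gap: "s \<le> \<bar>1 - real K / real N - w\<bar>"
  shows "\<exists>N'. K \<le> N' \<and> N' \<le> 2 * N \<and> ratio N N' K w \<le> exp (- real a * s / 4)"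
proof -
  define u where "u = real K / real N"
  have u: "0 \<le> u" "u \<le> 1" using K N by (auto simp: u_def)
  have Nu: "real K = u * real N" using N by (simp add: u_def)
  have ux: "4 * x * u \<le> s" using s by (simp add: u_def)
  have pw: "exp (- s / 4) ^ a = exp (- real a * s / 4)"
    by (simp flip: exp_of_nat_mult)
  consider "1 - u \<le> w - s" | "w + s \<le> 1 - u"
    using gap unfolding u_def by linarith
  then show ?thesis
  proof cases
    case 1
    have "ratio N (N + a) K w \<le> exp (- s / 4) ^ a"
    proof (rule ratio_up)
      fix j assume j: "1 \<le> j" "j \<le> a"
      \<comment> \<open>By \<open>(1 - x) * (1 + x) \<le> 1\<close>, enlarging lowers
        \<open>K / N\<close> by at most \<open>x * u\<close>, hence by at most a quarter of the
        gap.\<close>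
      have "u * (1 - x) * real (N + j) \<le> u * ((1 - x) * (1 + x) * real N)"
      proof -
        have "real (N + j) \<le> (1 + x) * real N" using j x by (simp add: algebra_simps)
        then have "(1 - x) * real (N + j) \<le> (1 - x) * ((1 + x) * real N)"
          using x by (intro mult_left_mono) auto
        then show ?thesis using u mult_left_mono by (metis mult.assoc)
      qed
      also have "\<dots> \<le> u * (1 * real N)"
        using u by (intro mult_left_mono mult_right_mono) (auto simp: algebra_simps)
      also have "\<dots> = real K" by (simp add: Nu)
      finally have "u * (1 - x) \<le> real K / real (N + j)"
        using N by (simp add: pos_le_divide_eq)
      moreover have "x * u \<le> s / 4" using ux by simp
      ultimately have "1 - real K / real (N + j) \<le> w - s / 2"
        using 1 s by (simp add: algebra_simps)
      also have "\<dots> \<le> (1 - s / 4) * w"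
      proof -
        have "s / 4 * w \<le> s / 4 * 1" using s w by (intro mult_left_mono) auto
        then show ?thesis using s by (simp add: algebra_simps)
      qed
      also have "\<dots> \<le> exp (- s / 4) * w"
        using w exp_ge_add_one_self[of "- s / 4"] by (intro mult_right_mono) auto
      finally show "1 - real K / real (N + j) \<le> exp (- s / 4) * w" .
    qed (use K w in auto)
    moreover have "x * real N \<le> 1/2 * real N" using x by (intro mult_right_mono) auto
    then have "N + a \<le> 2 * N" using x(3) by linarith
    ultimately show ?thesis using K pw by (intro exI[of _ "N + a"]) auto
  next
    case 2
    have s1: "s \<le> 1" using 2 u w by linarith
    have "x * real N \<le> 1/2 * real N" using x by (intro mult_right_mono) auto
    then have aN: "2 * a \<le> N" using x(3) by linarith
    define M where "M = N - a"
    have M: "N = M + a" "0 < M" using aN N by (auto simp: M_def)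
    have frac: "w + s / 2 \<le> 1 - real K / real (M + j)" for j
    proof -
      \<comment> \<open>For \<open>x \<le> 1/2\<close> the product
        \<open>(1 + 2 * x) * (1 - x)\<close> is at least 1, so shrinking raises \<open>K / N\<close>
        by at most \<open>2 * x * u\<close>, half of the gap.\<close>
      have "real K \<le> u * (1 + 2 * x) * (1 - x) * real N"
      proof -
        have "x * (2 * x) \<le> x * 1" using x by (intro mult_left_mono) auto
        then have "1 \<le> (1 + 2 * x) * (1 - x)" by (simp add: algebra_simps)
        then have "u * 1 * real N \<le> u * ((1 + 2 * x) * (1 - x)) * real N"
          using u by (intro mult_left_mono mult_right_mono) auto
        then show ?thesis by (simp add: Nu mult.assoc)
      qed
      also have "\<dots> = u * (1 + 2 * x) * ((1 - x) * real N)" by simp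
      also have "\<dots> \<le> u * (1 + 2 * x) * real (M + j)"
      proof (rule mult_left_mono)
        have "(1 - x) * real N \<le> real N - real a" using x by (simp add: algebra_simps)
        also have "\<dots> \<le> real (M + j)" using M by simp
        finally show "(1 - x) * real N \<le> real (M + j)" .
      qed (use u x in auto)
      finally have "real K / real (M + j) \<le> u * (1 + 2 * x)"
        using M by (simp add: pos_divide_le_eq)
      then show ?thesis using 2 ux by (simp add: algebra_simps)
    qed
    have "ratio (M + a) M K w \<le> exp (- s / 4) ^ a"
    proof (rule ratio_down)
      have "real K / real M < 1" using frac[of 0] w s by simp
      then show "K \<le> M" using M by simp
      fix j
      have "exp (s / 4) \<le> 1 + s / 4 + (s / 4)\<^sup>2"
        using s s1 by (intro exp_bound) auto
      also have "\<dots> \<le> 1 + s / 2"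
      proof -
        have "(s / 4) * (s / 4) \<le> (s / 4) * 1" using s s1 by (intro mult_left_mono) auto
        then show ?thesis by (simp add: power2_eq_square)
      qed
      finally have "w * exp (s / 4) \<le> w * (1 + s / 2)" using w by (intro mult_left_mono) auto
      also have "\<dots> \<le> w + s / 2"
      proof -
        have "w * (s / 2) \<le> 1 * (s / 2)" using w s by (intro mult_right_mono) auto
        then show ?thesis by (simp add: algebra_simps)
      qed
      also have "\<dots> \<le> 1 - real K / real (M + j)" by (rule frac)
      finally have "exp (- s / 4) * (w * exp (s / 4)) \<le> exp (- s / 4) * (1 - real K / real (M + j))"
        by (intro mult_left_mono) auto
      then show "w \<le> exp (- s / 4) * (1 - real K / real (M + j))"
        by (simp add: mult.left_commute flip: exp_add)
    qed (use w in auto)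
    moreover have "K \<le> M"
    proof -
      have "real K / real M < 1" using frac[of 0] w s by simp
      then show ?thesis using M by simp
    qed
    ultimately show ?thesis using pw M by (intro exI[of _ M]) auto
  qed
qed

text \<open>Compare descending products factor by factor:
  \<open>N - i \<le> N \<le> b * (N' - K) \<le> b * (N' - i)\<close>.\<close>

lemma binomial_le_power_mult:
  assumes "K \<le> N" "K \<le> N'" "0 \<le> b" "real N \<le> b * (real N' - real K)"
  shows "real (N choose K) \<le> b ^ K * real (N' choose K)"
  using assms(1,2,4)
proof (induction K)
  case (Suc K)
  have step: "real (M choose Suc K) * real (Suc K) = real (M choose K) * (real M - real K)"
    if "Suc K \<le> M" for M
  proof -
    have "Suc K * (M choose Suc K) = (M - K) * (M choose K)"
      using binomial_absorption[of K M] binomial_absorb_comp[of M K] by simp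
    then have "real (Suc K) * real (M choose Suc K) = real (M - K) * real (M choose K)"
      by (metis of_nat_mult)
    moreover have "real (M - K) = real M - real K" using that by (intro of_nat_diff) simp
    ultimately show ?thesis by (metis mult.commute)
  qed
  have "b * (real N' - real (Suc K)) \<le> b * (real N' - real K)"
    using assms(3) by (intro mult_left_mono) auto
  then have N: "real N \<le> b * (real N' - real K)" using Suc.prems by linarith
  have "real (N choose Suc K) * real (Suc K) = real (N choose K) * (real N - real K)"
    using Suc.prems by (intro step)
  also have "\<dots> \<le> (b ^ K * real (N' choose K)) * (b * (real N' - real K))"
    using Suc N assms(3) by (intro mult_mono) auto
  also have "\<dots> = b ^ Suc K * (real (N' choose K) * (real N' - real K))"
    by simp
  also have "real (N' choose K) * (real N' - real K) = real (N' choose Suc K) * real (Suc K)"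
    using Suc.prems by (intro step[symmetric])
  finally show ?case by (simp add: mult.assoc[symmetric] del: of_nat_Suc binomial_Suc_Suc)
qed simp

text \<open>The powers are exchanged crosswise: \<open>(q ^ l) ^ (n - n')\<close> is rewritten as
  \<open>(q ^ (n - n')) ^ l\<close> and joined to the binomials in \<open>m\<close>, and
  symmetrically. Each of the two groups is then at most 1 by one of the last two hypotheses.\<close>

lemma ratio_prod_le_1:
  assumes q: "0 < q" and k: "k \<le> n'" "n' \<le> n" and l: "l \<le> m'" "m' \<le> m"
    and n: "real n * q ^ (m - m') \<le> real n' - real k"
    and m: "real m * q ^ (n - n') \<le> real m' - real l"
  shows "ratio n n' k (q ^ l) * ratio m m' l (q ^ k) \<le> 1"
proof -
  have frac: "real (N choose K) * v ^ K / real (N' choose K) \<le> 1"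
    if "K \<le> N'" "N' \<le> N" "0 < v" "real N * v \<le> real N' - real K" for N N' K and v :: real
  proof -
    have "real (N choose K) \<le> (1 / v) ^ K * real (N' choose K)"
      using that by (intro binomial_le_power_mult) (auto simp: field_simps)
    then show ?thesis using that by (simp add: field_simps power_divide)
  qed
  have split: "ratio N N' K w = real (N choose K) * w ^ (N - N') / real (N' choose K)"
    if "K \<le> N'" "N' \<le> N" "0 < w" for N N' K and w :: real
  proof -
    have "w ^ (N - K) = w ^ (N - N') * w ^ (N' - K)" using that by (simp flip: power_add)
    then show ?thesis using that by (simp add: ratio_def)
  qed
  have "ratio n n' k (q ^ l) * ratio m m' l (q ^ k) =
      (real (n choose k) * (q ^ (m - m')) ^ k / real (n' choose k)) *
      (real (m choose l) * (q ^ (n - n')) ^ l / real (m' choose l))"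
    using q k l by (simp add: split mult_ac flip: power_mult)
  also have "\<dots> \<le> 1"
    by (intro mult_le_one frac) (use q k l n m in auto)
  finally show ?thesis .
qed

subsection \<open>Fixed points of the generating function\<close>

lemma g_cp_deriv:
  "(g_cp \<beta> \<gamma> has_real_derivative \<beta> * \<gamma>\<^sup>2 * exp (\<gamma> * (s - 1)) * g_cp \<beta> \<gamma> s) (at s)"
  unfolding g_cp_def[abs_def]
  by (auto intro!: derivative_eq_intros simp: power2_eq_square)

lemma g_cp_1 [simp]: "g_cp \<beta> \<gamma> 1 = 1"
  by (simp add: g_cp_def)

lemma g_cp_pos: "0 < g_cp \<beta> \<gamma> s"
  by (simp add: g_cp_def)

lemma continuous_on_g_cp [continuous_intros]:
  "continuous_on A f \<Longrightarrow> continuous_on A (\<lambda>x. g_cp \<beta> \<gamma> (f x))"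
  unfolding g_cp_def by (intro continuous_intros)

text \<open>Applying \<open>exp y \<ge> 1 + y\<close> twice gives
  \<open>g (1 - x) \<ge> 1 - \<mu> * x\<close> with
  \<open>\<mu> = \<beta> * \<gamma>\<^sup>2\<close>.\<close>

lemma g_cp_gap_subcritical:
  assumes "0 \<le> \<beta>" "0 \<le> \<gamma>"
  shows "(1 - \<beta> * \<gamma>\<^sup>2) * x \<le> \<bar>1 - x - g_cp \<beta> \<gamma> (1 - x)\<bar>"
proof -
  have "\<beta> * \<gamma> * (- \<gamma> * x) \<le> \<beta> * \<gamma> * (exp (- \<gamma> * x) - 1)"
    using assms exp_ge_add_one_self[of "- \<gamma> * x"] by (intro mult_left_mono) auto
  also have "1 + \<dots> \<le> exp (\<beta> * \<gamma> * (exp (- \<gamma> * x) - 1))"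
    by (rule exp_ge_add_one_self)
  finally show ?thesis
    by (simp add: g_cp_def power2_eq_square algebra_simps)
qed

context
  fixes \<beta> \<gamma> :: real
  assumes pos: "0 < \<beta>" "0 < \<gamma>" and super: "1 < \<beta> * \<gamma>\<^sup>2"
begin

text \<open>The derivative of \<open>g s - s\<close> at 1 is
  \<open>\<beta> * \<gamma>\<^sup>2 - 1 > 0\<close>; close to 1 the difference quotient exceeds half
  of it.\<close>

lemma g_cp_slope_at_1:
  "\<exists>d>0. \<forall>x. 0 < x \<and> x < d \<longrightarrow> (\<beta> * \<gamma>\<^sup>2 - 1) / 2 * x < 1 - x - g_cp \<beta> \<gamma> (1 - x)"
proof -
  have "((\<lambda>s. g_cp \<beta> \<gamma> s - s) has_real_derivative \<beta> * \<gamma>\<^sup>2 - 1) (at 1)"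
    using g_cp_deriv[of \<beta> \<gamma> 1] by (auto intro!: derivative_eq_intros)
  then have "(\<lambda>h. (g_cp \<beta> \<gamma> (1 + h) - (1 + h)) / h) \<midarrow>0\<rightarrow> \<beta> * \<gamma>\<^sup>2 - 1"
    by (simp add: DERIV_def)
  moreover have "(\<beta> * \<gamma>\<^sup>2 - 1) / 2 < \<beta> * \<gamma>\<^sup>2 - 1" using super by simp
  ultimately have "\<forall>\<^sub>F h in at 0. (\<beta> * \<gamma>\<^sup>2 - 1) / 2 < (g_cp \<beta> \<gamma> (1 + h) - (1 + h)) / h"
    by (rule order_tendstoD)
  then obtain d where d: "d > 0"
    "\<And>h. h \<noteq> 0 \<Longrightarrow> \<bar>h\<bar> < d \<Longrightarrow> (\<beta> * \<gamma>\<^sup>2 - 1) / 2 < (g_cp \<beta> \<gamma> (1 + h) - (1 + h)) / h"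
    by (auto simp: eventually_at dist_real_def)
  show ?thesis
  proof (intro exI conjI allI impI)
    fix x :: real assume "0 < x \<and> x < d"
    then have "(\<beta> * \<gamma>\<^sup>2 - 1) / 2 < (1 - x - g_cp \<beta> \<gamma> (1 - x)) / x"
      using d(2)[of "- x"] by (simp add: minus_divide_left)
    then show "(\<beta> * \<gamma>\<^sup>2 - 1) / 2 * x < 1 - x - g_cp \<beta> \<gamma> (1 - x)"
      using \<open>0 < x \<and> x < d\<close> by (simp add: pos_less_divide_eq)
  qed (rule d(1))
qed

lemma g_cp_below_near_1:
  assumes "s < 1"
  shows "\<exists>t. s < t \<and> t < 1 \<and> g_cp \<beta> \<gamma> t < t"
proof -
  obtain d where d: "d > 0"
    "\<And>x. 0 < x \<Longrightarrow> x < d \<Longrightarrow> (\<beta> * \<gamma>\<^sup>2 - 1) / 2 * x < 1 - x - g_cp \<beta> \<gamma> (1 - x)"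
    using g_cp_slope_at_1 by blast
  define x where "x = min d (1 - s) / 2"
  have x: "0 < x" "x < d" "x < 1 - s" using d(1) assms by (auto simp: x_def)
  have "0 < (\<beta> * \<gamma>\<^sup>2 - 1) / 2 * x" using x super by simp
  then have "g_cp \<beta> \<gamma> (1 - x) < 1 - x" using d(2)[OF x(1,2)] by linarith
  then show ?thesis using x by (intro exI[of _ "1 - x"]) auto
qed

lemma g_cp_root_between:
  assumes "a \<le> b" "a \<le> g_cp \<beta> \<gamma> a" "g_cp \<beta> \<gamma> b \<le> b"
  shows "\<exists>s. a \<le> s \<and> s \<le> b \<and> g_cp \<beta> \<gamma> s = s"
proof -
  have "continuous_on {a..b} (\<lambda>s. s - g_cp \<beta> \<gamma> s)" by (intro continuous_intros)
  then show ?thesis using IVT'[of "\<lambda>s. s - g_cp \<beta> \<gamma> s" a 0 b] assms by auto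
qed

text \<open>Since \<open>g 0 > 0\<close> and \<open>g\<close> lies below the diagonal somewhere
  before 1, there is a root in between. The set of roots is closed, so its infimum is
  attained.\<close>

lemma rho_ext_root: "0 < rho_ext \<beta> \<gamma>" "rho_ext \<beta> \<gamma> < 1"
    "g_cp \<beta> \<gamma> (rho_ext \<beta> \<gamma>) = rho_ext \<beta> \<gamma>"
  and rho_ext_le: "0 \<le> s \<Longrightarrow> g_cp \<beta> \<gamma> s = s \<Longrightarrow> rho_ext \<beta> \<gamma> \<le> s"
proof -
  let ?S = "{s. 0 \<le> s \<and> g_cp \<beta> \<gamma> s = s}"
  obtain t where t: "0 < t" "t < 1" "g_cp \<beta> \<gamma> t < t"
    using g_cp_below_near_1[of 0] by auto
  obtain r where r: "0 \<le> r" "r \<le> t" "g_cp \<beta> \<gamma> r = r"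
    using g_cp_root_between[of 0 t] t g_cp_pos[of \<beta> \<gamma> 0] by auto
  have bdd: "bdd_below ?S" by (rule bdd_belowI[of _ 0]) auto
  have "closed ?S"
    by (intro closed_Collect_conj closed_Collect_le closed_Collect_eq continuous_intros)
  then have mem: "rho_ext \<beta> \<gamma> \<in> ?S"
    unfolding rho_ext_def using r bdd by (intro closed_contains_Inf) auto
  show le: "rho_ext \<beta> \<gamma> \<le> s" if "0 \<le> s" "g_cp \<beta> \<gamma> s = s" for s
    unfolding rho_ext_def using that bdd by (intro cInf_lower) auto
  show "g_cp \<beta> \<gamma> (rho_ext \<beta> \<gamma>) = rho_ext \<beta> \<gamma>" using mem by simp
  then show "0 < rho_ext \<beta> \<gamma>" using g_cp_pos by metis
  show "rho_ext \<beta> \<gamma> < 1" using le[of r] r t by simp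
qed

text \<open>A third fixed point would force, by Rolle's theorem applied twice, the strictly
  increasing derivative of \<open>g\<close> to take the value \<open>1\<close> twice.\<close>
lemma g_cp_no_root:
  assumes "rho_ext \<beta> \<gamma> < s" "s < 1"
  shows "g_cp \<beta> \<gamma> s \<noteq> s"
proof
  assume root: "g_cp \<beta> \<gamma> s = s"
  define g' where "g' = (\<lambda>s. \<beta> * \<gamma>\<^sup>2 * exp (\<gamma> * (s - 1)) * g_cp \<beta> \<gamma> s)"
  have deriv: "((\<lambda>s. g_cp \<beta> \<gamma> s - s) has_real_derivative g' x - 1) (at x)" for x
    using g_cp_deriv[of \<beta> \<gamma> x] by (auto intro!: derivative_eq_intros simp: g'_def)
  have rolle: "\<exists>z. a < z \<and> z < b \<and> g' z = 1"
    if ab: "a < b" "g_cp \<beta> \<gamma> a = a" "g_cp \<beta> \<gamma> b = b" for a b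
  proof -
    obtain z where z: "a < z" "z < b" "g_cp \<beta> \<gamma> b - b - (g_cp \<beta> \<gamma> a - a) = (b - a) * (g' z - 1)"
      using MVT2[OF ab(1), of "\<lambda>s. g_cp \<beta> \<gamma> s - s" "\<lambda>z. g' z - 1"] deriv by auto
    then have "(b - a) * (g' z - 1) = 0" using that by simp
    then show ?thesis using z that by auto
  qed
  obtain y where y: "y < s" "g' y = 1"
    using rolle[of "rho_ext \<beta> \<gamma>" s] assms rho_ext_root root by auto
  obtain z where z: "s < z" "g' z = 1"
    using rolle[of s 1] assms root by auto
  have yz: "\<gamma> * (y - 1) < \<gamma> * (z - 1)" using y z pos by simp
  then have "g_cp \<beta> \<gamma> y \<le> g_cp \<beta> \<gamma> z"
    using pos by (auto simp: g_cp_def intro!: mult_left_mono)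
  then have "exp (\<gamma> * (y - 1)) * g_cp \<beta> \<gamma> y < exp (\<gamma> * (z - 1)) * g_cp \<beta> \<gamma> z"
    using yz g_cp_pos[of \<beta> \<gamma> y] by (intro mult_less_le_imp_less) auto
  then have "(\<beta> * \<gamma>\<^sup>2) * (exp (\<gamma> * (y - 1)) * g_cp \<beta> \<gamma> y)
      < (\<beta> * \<gamma>\<^sup>2) * (exp (\<gamma> * (z - 1)) * g_cp \<beta> \<gamma> z)"
    using pos by (intro mult_strict_left_mono) auto
  then have "g' y < g' z" by (simp add: g'_def mult.assoc)
  then show False using y z by simp
qed

text \<open>Otherwise the intermediate value theorem, used with a point closer to 1 where
  \<open>g\<close> is below the diagonal, gives a forbidden root.\<close>

lemma g_cp_less:
  assumes "rho_ext \<beta> \<gamma> < s" "s < 1"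
  shows "g_cp \<beta> \<gamma> s < s"
proof (rule ccontr)
  assume "\<not> g_cp \<beta> \<gamma> s < s"
  moreover obtain t where "s < t" "t < 1" "g_cp \<beta> \<gamma> t < t"
    using g_cp_below_near_1 assms by blast
  ultimately obtain r where "s \<le> r" "r \<le> t" "g_cp \<beta> \<gamma> r = r"
    using g_cp_root_between[of s t] by auto
  then show False using g_cp_no_root[of r] assms \<open>t < 1\<close> by simp
qed

text \<open>The bound is linear in \<open>x\<close> because the gap vanishes at 0. Near 0 it comes
  from the slope at 1; on the rest, with a neighbourhood of \<open>1 - \<rho>\<close> removed, from
  compactness.\<close>

lemma g_cp_gap_supercritical:
  assumes "0 < \<epsilon>"
  shows "\<exists>c>0. \<forall>x\<in>{0..1}. \<epsilon> \<le> \<bar>x - (1 - rho_ext \<beta> \<gamma>)\<bar> \<longrightarrow> c * x \<le> \<bar>1 - x - g_cp \<beta> \<gamma> (1 - x)\<bar>"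
proof -
  let ?\<rho> = "rho_ext \<beta> \<gamma>"
  let ?h = "\<lambda>x. \<bar>1 - x - g_cp \<beta> \<gamma> (1 - x)\<bar>"
  obtain d where d: "d > 0"
    "\<And>x. 0 < x \<Longrightarrow> x < d \<Longrightarrow> (\<beta> * \<gamma>\<^sup>2 - 1) / 2 * x < 1 - x - g_cp \<beta> \<gamma> (1 - x)"
    using g_cp_slope_at_1 by blast
  define S where "S = {x. d \<le> x \<and> x \<le> 1 \<and> \<epsilon> \<le> \<bar>x - (1 - ?\<rho>)\<bar>}"
  have "compact S"
  unfolding compact_eq_bounded_closed
  proof
    show "bounded S" by (rule bounded_subset[of "{d..1}"]) (auto simp: S_def)
    show "closed S" unfolding S_def
      by (intro closed_Collect_conj closed_Collect_le continuous_intros)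
  qed
  have "\<exists>c>0. \<forall>x\<in>S. c \<le> ?h x"
  proof (cases "S = {}")
    case False
    have "continuous_on S ?h" by (intro continuous_intros)
    then obtain z where z: "z \<in> S" "\<And>x. x \<in> S \<Longrightarrow> ?h z \<le> ?h x"
      using continuous_attains_inf[OF \<open>compact S\<close> False] by blast
    have "g_cp \<beta> \<gamma> (1 - z) \<noteq> 1 - z"
    proof
      assume root: "g_cp \<beta> \<gamma> (1 - z) = 1 - z"
      then have "?\<rho> \<le> 1 - z" using rho_ext_le[of "1 - z"] z(1) by (simp add: S_def)
      moreover have "1 - z < 1" using z(1) d(1) by (simp add: S_def)
      ultimately have "1 - z = ?\<rho>" using g_cp_no_root[of "1 - z"] root by force
      then show False using z(1) assms by (auto simp: S_def)
    qed
    then show ?thesis using z by (intro exI[of _ "?h z"]) auto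
  qed (auto intro: exI[of _ 1])
  then obtain c where c: "c > 0" "\<And>x. x \<in> S \<Longrightarrow> c \<le> ?h x" by blast
  show ?thesis
  proof (intro exI[of _ "min c ((\<beta> * \<gamma>\<^sup>2 - 1) / 2)"] conjI ballI impI)
    show "0 < min c ((\<beta> * \<gamma>\<^sup>2 - 1) / 2)" using c super by simp
    fix x :: real assume x: "x \<in> {0..1}" "\<epsilon> \<le> \<bar>x - (1 - ?\<rho>)\<bar>"
    let ?c = "min c ((\<beta> * \<gamma>\<^sup>2 - 1) / 2)"
    consider "x = 0" | "0 < x" "x < d" | "x \<in> S"
      using x by (force simp: S_def)
    then show "?c * x \<le> ?h x"
    proof cases
      case 2
      have "?c * x \<le> (\<beta> * \<gamma>\<^sup>2 - 1) / 2 * x"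
        using 2 by (intro mult_right_mono min.cobounded2) auto
      then show ?thesis using d(2)[OF 2] by linarith
    next
      case 3
      have "?c * x \<le> c * 1" using x c by (intro mult_mono) auto
      then show ?thesis using c(2)[OF 3] by linarith
    qed simp
  qed
qed

end

section \<open>From the two size equations to approximate fixed points\<close>

lemma exp_diff_le:
  fixes a b :: real
  assumes "a \<le> 0" "b \<le> 0"
  shows "\<bar>exp a - exp b\<bar> \<le> \<bar>a - b\<bar>"
proof -
  have *: "exp y - exp x \<le> y - x" if "x \<le> y" "y \<le> 0" for x y :: real
  proof -
    have "exp y * (1 + (x - y)) \<le> exp y * exp (x - y)"
      by (intro mult_left_mono exp_ge_add_one_self) auto
    also have "\<dots> = exp x" by (simp flip: exp_add)
    finally have "exp y - exp x \<le> exp y * (y - x)" by (simp add: algebra_simps)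
    also have "\<dots> \<le> 1 * (y - x)" using that by (intro mult_right_mono) auto
    finally show ?thesis by simp
  qed
  show ?thesis
  proof (cases "a \<le> b")
    case True
    then show ?thesis using *[of a b] assms by auto
  next
    case False
    then show ?thesis using *[of b a] assms by (auto simp: not_le)
  qed
qed

text \<open>Here \<open>x\<close> and \<open>y\<close> stand for \<open>k / n\<close> and
  \<open>l / n\<close>. The second equation determines \<open>y\<close> up to an error, and
  inserting this into the first gives the fixed point equation. The condition on \<open>c\<close>
  lets half of \<open>x + y\<close> be absorbed, which turns errors relative to \<open>x + y\<close>
  into errors relative to \<open>x\<close>.\<close>

lemma g_cp_approx_fixed_point:
  assumes pos: "0 < \<beta>" "0 < \<gamma>" and xy: "0 \<le> x" "0 \<le> y"
    and c: "0 \<le> c" "2 * \<beta> * c \<le> 1"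
    and 1: "\<bar>1 - x - exp (- \<gamma> * y)\<bar> \<le> c * (x + y)"
    and 2: "\<bar>1 - y / \<beta> - exp (- \<gamma> * x)\<bar> \<le> c * (x + y)"
  shows "x + y \<le> 2 * (1 + \<beta> * \<gamma>) * x"
    and "\<bar>1 - x - g_cp \<beta> \<gamma> (1 - x)\<bar> \<le> 2 * (1 + \<beta> * \<gamma>)\<^sup>2 * c * x"
proof -
  let ?t = "x + y"
  \<comment> \<open>The exact solution \<open>y\<close> of the second equation; it satisfies
    \<open>exp (- \<gamma> * z) = g (1 - x)\<close>.\<close>
  define z where "z = \<beta> * (1 - exp (- \<gamma> * x))"
  have "y - z = - \<beta> * (1 - y / \<beta> - exp (- \<gamma> * x))"
    using pos by (simp add: z_def algebra_simps)
  then have "\<bar>y - z\<bar> = \<beta> * \<bar>1 - y / \<beta> - exp (- \<gamma> * x)\<bar>"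
    using pos by (simp add: abs_mult)
  also have "\<dots> \<le> \<beta> * (c * ?t)" using 2 pos by (intro mult_left_mono) auto
  finally have yz: "\<bar>y - z\<bar> \<le> \<beta> * c * ?t" by (simp add: mult.assoc)
  have "z \<le> \<beta> * (\<gamma> * x)"
    unfolding z_def using pos exp_ge_add_one_self[of "- \<gamma> * x"] by (intro mult_left_mono) auto
  moreover have "\<beta> * c * ?t \<le> 1 / 2 * ?t" using c xy by (intro mult_right_mono) auto
  ultimately show t: "?t \<le> 2 * (1 + \<beta> * \<gamma>) * x"
    using yz by (simp add: algebra_simps)
  have z0: "0 \<le> z" using pos xy by (simp add: z_def)
  have g: "g_cp \<beta> \<gamma> (1 - x) = exp (- \<gamma> * z)"
    by (simp add: g_cp_def z_def algebra_simps)
  have "\<bar>exp (- \<gamma> * y) - exp (- \<gamma> * z)\<bar> \<le> \<bar>- \<gamma> * y - - \<gamma> * z\<bar>"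
    using pos xy z0 by (intro exp_diff_le) auto
  also have "\<dots> = \<gamma> * \<bar>y - z\<bar>"
    using pos by (simp add: abs_mult abs_minus_commute flip: right_diff_distrib)
  also have "\<dots> \<le> \<gamma> * (\<beta> * c * ?t)" using yz pos by (intro mult_left_mono) auto
  finally have "\<bar>1 - x - g_cp \<beta> \<gamma> (1 - x)\<bar> \<le> c * ?t + \<gamma> * (\<beta> * c * ?t)"
    unfolding g using 1 by linarith
  also have "\<dots> = (1 + \<beta> * \<gamma>) * c * ?t" by (simp add: algebra_simps)
  also have "\<dots> \<le> (1 + \<beta> * \<gamma>) * c * (2 * (1 + \<beta> * \<gamma>) * x)"
    using t pos c by (intro mult_left_mono) auto
  also have "\<dots> = 2 * (1 + \<beta> * \<gamma>)\<^sup>2 * c * x"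
    by (simp add: power2_eq_square)
  finally show "\<bar>1 - x - g_cp \<beta> \<gamma> (1 - x)\<bar> \<le> 2 * (1 + \<beta> * \<gamma>)\<^sup>2 * c * x" .
qed

text \<open>For one factor the error is at most \<open>p\<^sup>2\<close>, and the
  \<open>l\<close>-th powers of two numbers in the unit interval differ by at most \<open>l\<close>
  times their difference.\<close>

lemma power_one_minus_approx:
  assumes "0 \<le> p" "p \<le> 1"
  shows "\<bar>(1 - p) ^ l - exp (- p * real l)\<bar> \<le> real l * p\<^sup>2"
proof -
  have "exp (- p) * (1 + p) \<le> exp (- p) * exp p"
    by (intro mult_left_mono exp_ge_add_one_self) auto
  also have "\<dots> \<le> 1 + p ^ 3" using assms by (simp flip: exp_add)
  also have "\<dots> = (1 - p + p\<^sup>2) * (1 + p)" by (simp add: power2_eq_square power3_eq_cube algebra_simps)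
  finally have "exp (- p) \<le> 1 - p + p\<^sup>2" using assms by (simp add: mult_le_cancel_right)
  then have p: "\<bar>(1 - p) - exp (- p)\<bar> \<le> p\<^sup>2"
    using exp_ge_add_one_self[of "- p"] by (simp add: abs_le_iff)
  have "norm ((1 - p) ^ l - exp (- p) ^ l) \<le> real l * norm ((1 - p) - exp (- p))"
    using assms by (intro norm_power_diff) auto
  also have "\<dots> \<le> real l * p\<^sup>2" using p by (intro mult_left_mono) auto
  finally show ?thesis by (simp add: mult.commute flip: exp_of_nat_mult)
qed

lemma aux_num_bounds:
  assumes "0 \<le> \<beta>"
  shows "real (aux_num \<beta> n) \<le> \<beta> * real n" "\<beta> * real n - 1 < real (aux_num \<beta> n)"
proof -
  have "0 \<le> \<lfloor>\<beta> * real n\<rfloor>" using assms by simp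
  then have "real (aux_num \<beta> n) = of_int \<lfloor>\<beta> * real n\<rfloor>" by (simp add: aux_num_def)
  then show "real (aux_num \<beta> n) \<le> \<beta> * real n" "\<beta> * real n - 1 < real (aux_num \<beta> n)"
    by linarith+
qed

subsection \<open>Exponential decay away from the giant component\<close>

lemma eventually_real_ge: "\<forall>\<^sub>F n in sequentially. X \<le> real n"
  using filterlim_real_sequentially by (auto simp: filterlim_at_top)

text \<open>If both alternatives failed, \<open>k / n\<close> and \<open>l / n\<close> would solve
  the two limiting equations up to \<open>2 * c\<close>: one \<open>c\<close> from the failure, one
  for the discretisation errors of order \<open>1 / n\<close>. This contradicts the gap of
  \<open>g\<close>.\<close>

lemma discrete_gap:
  assumes pos: "0 < \<beta>" "0 < \<gamma>" and c0: "0 < c0"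
    and gap: "\<And>x. x \<in> {0..1} \<Longrightarrow> P x \<Longrightarrow> c0 * x \<le> \<bar>1 - x - g_cp \<beta> \<gamma> (1 - x)\<bar>"
  shows "\<exists>c>0. \<forall>\<^sub>F n in sequentially. \<forall>k l. k \<le> n \<longrightarrow> l \<le> aux_num \<beta> n \<longrightarrow> P (real k / real n) \<longrightarrow>
    c * (real (k + l) / real n) \<le> \<bar>1 - real k / real n - (1 - \<gamma> / real n) ^ l\<bar> \<or>
    c * (real (k + l) / real n) \<le> \<bar>1 - real l / real (aux_num \<beta> n) - (1 - \<gamma> / real n) ^ k\<bar>"
proof -
  define A where "A = (1 + \<beta> * \<gamma>)\<^sup>2"
  have A: "0 < A" unfolding A_def using pos by (intro zero_less_power add_pos_pos) auto
  \<comment> \<open>The first bound makes \<open>2 * A * (2 * c)\<close> smaller than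
    \<open>c0\<close>; the second is the condition of \<open>g_cp_approx_fixed_point\<close> for
    \<open>2 * c\<close>.\<close>
  define c where "c = min (c0 / (8 * A)) (1 / (4 * \<beta>))"
  have c: "0 < c" "4 * A * c < c0" "2 * \<beta> * (2 * c) \<le> 1"
  proof -
    show "0 < c" using pos A c0 by (simp add: c_def)
    have "c \<le> c0 / (8 * A)" by (simp add: c_def)
    then have "c * (8 * A) \<le> c0" using A by (simp add: pos_le_divide_eq)
    then show "4 * A * c < c0" using c0 by (simp add: mult_ac)
    have "c \<le> 1 / (4 * \<beta>)" by (simp add: c_def)
    then show "2 * \<beta> * (2 * c) \<le> 1" using pos by (simp add: pos_le_divide_eq mult_ac)
  qed
  \<comment> \<open>The term \<open>\<gamma>\<^sup>2\<close> comes from replacing powers by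
    exponentials, \<open>2 / \<beta>\<^sup>2\<close> from replacing \<open>l / m\<close> by
    \<open>l / (\<beta> * n)\<close>.\<close>
  define E where "E = \<gamma>\<^sup>2 + 2 / \<beta>\<^sup>2"
  have E: "\<gamma>\<^sup>2 \<le> E" "0 \<le> E" using pos by (auto simp: E_def)
  have "\<forall>\<^sub>F n in sequentially. max (max 1 \<gamma>) (max (2 / \<beta>) (E / c)) \<le> real n"
    by (rule eventually_real_ge)
  then have "\<forall>\<^sub>F n in sequentially. \<forall>k l. k \<le> n \<longrightarrow> l \<le> aux_num \<beta> n \<longrightarrow> P (real k / real n) \<longrightarrow>
    c * (real (k + l) / real n) \<le> \<bar>1 - real k / real n - (1 - \<gamma> / real n) ^ l\<bar> \<or>
    c * (real (k + l) / real n) \<le> \<bar>1 - real l / real (aux_num \<beta> n) - (1 - \<gamma> / real n) ^ k\<bar>"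
  proof eventually_elim
    case (elim n)
    then have n: "1 \<le> real n" "\<gamma> \<le> real n" "2 / \<beta> \<le> real n" "E / c \<le> real n" by auto
    define m where "m = aux_num \<beta> n"
    have bn: "2 \<le> \<beta> * real n" using n(3) pos by (simp add: pos_divide_le_eq mult.commute)
    have m: "real m \<le> \<beta> * real n" "\<beta> * real n - 1 < real m"
      using aux_num_bounds[of \<beta> n] pos by (auto simp: m_def)
    then have m2: "\<beta> * real n / 2 \<le> real m" using bn by linarith
    have Ec: "E / real n \<le> c" using n c by (simp add: field_simps)
    show ?case
    proof (intro allI impI, fold m_def)
      fix k l assume k: "k \<le> n" and l: "l \<le> m" and P: "P (real k / real n)"
      define x y where "x = real k / real n" and "y = real l / real n"
      have xy: "0 \<le> x" "x \<le> 1" "0 \<le> y" using k n by (auto simp: x_def y_def)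
      have t: "real (k + l) / real n = x + y" by (simp add: x_def y_def add_divide_distrib)
      have pw: "\<bar>(1 - \<gamma> / real n) ^ j - exp (- \<gamma> * (real j / real n))\<bar> \<le> \<gamma>\<^sup>2 / real n * (real j / real n)" for j
        using power_one_minus_approx[of "\<gamma> / real n" j] pos n
        by (simp add: power2_eq_square divide_simps mult_ac)
      have lm: "\<bar>real l / real m - y / \<beta>\<bar> \<le> 2 / \<beta>\<^sup>2 / real n * y"
      proof -
        have mpos: "0 < real m" using m2 bn by linarith
        have "real l / real m - y / \<beta> = real l * (\<beta> * real n - real m) / (real m * (\<beta> * real n))"
          using mpos bn pos n by (simp add: y_def field_simps)
        moreover have "0 \<le> real l * (\<beta> * real n - real m) / (real m * (\<beta> * real n))"
          using m(1) pos by (intro divide_nonneg_nonneg mult_nonneg_nonneg) auto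
        ultimately have "\<bar>real l / real m - y / \<beta>\<bar> =
            real l * (\<beta> * real n - real m) / (real m * (\<beta> * real n))"
          by (simp only: abs_of_nonneg)
        also have "\<dots> \<le> real l * 1 / (\<beta> * real n / 2 * (\<beta> * real n))"
          using m m2 bn mpos by (intro frac_le mult_left_mono mult_right_mono) auto
        also have "\<dots> = 2 / \<beta>\<^sup>2 / real n * y" by (simp add: y_def power2_eq_square mult_ac)
        finally show ?thesis .
      qed
      show "c * (real (k + l) / real n) \<le> \<bar>1 - real k / real n - (1 - \<gamma> / real n) ^ l\<bar> \<or>
        c * (real (k + l) / real n) \<le> \<bar>1 - real l / real m - (1 - \<gamma> / real n) ^ k\<bar>"
      proof (rule ccontr)
        assume "\<not> ?thesis"
        then have 1: "\<bar>1 - x - (1 - \<gamma> / real n) ^ l\<bar> < c * (x + y)"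
          and 2: "\<bar>1 - real l / real m - (1 - \<gamma> / real n) ^ k\<bar> < c * (x + y)"
          unfolding t by (auto simp: x_def)
        have tpos: "0 < x + y" using 1 c(1) xy
          by (metis abs_ge_zero le_less_trans zero_less_mult_pos)
        have err: "E / real n * (x + y) \<le> c * (x + y)"
          using Ec tpos by (intro mult_right_mono) auto
        have "\<gamma>\<^sup>2 / real n * y \<le> E / real n * (x + y)"
          using E n xy by (intro mult_mono divide_right_mono) auto
        then have 1: "\<bar>1 - x - exp (- \<gamma> * y)\<bar> \<le> 2 * c * (x + y)"
          using 1 pw[of l] err unfolding y_def[symmetric] by linarith
        have "\<gamma>\<^sup>2 / real n * x + 2 / \<beta>\<^sup>2 / real n * y
            \<le> \<gamma>\<^sup>2 / real n * (x + y) + 2 / \<beta>\<^sup>2 / real n * (x + y)"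
          using xy n by (intro add_mono mult_left_mono) auto
        also have "\<dots> = E / real n * (x + y)"
          by (simp add: E_def algebra_simps add_divide_distrib)
        finally have 2: "\<bar>1 - y / \<beta> - exp (- \<gamma> * x)\<bar> \<le> 2 * c * (x + y)"
          using 2 pw[of k] lm err unfolding x_def[symmetric] by linarith
        note fp = g_cp_approx_fixed_point[OF pos xy(1,3) _ c(3) 1 2]
        have "x > 0"
        proof (rule ccontr)
          assume "\<not> x > 0"
          then have "x = 0" using xy by simp
          then show False using fp(1) c tpos by simp
        qed
        have "c0 * x \<le> 2 * A * (2 * c) * x"
          using gap[of x] P xy fp(2) c(1) unfolding A_def x_def by force
        also have "\<dots> < c0 * x" using c(2) \<open>x > 0\<close> by simp
        finally show False by simp
      qed
    qed
  qed
  then show ?thesis using c(1) by blast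
qed

text \<open>A gap on either side makes it profitable to change the corresponding number of vertices by a
  small proportion, upwards or downwards according to the sign of the gap.\<close>
lemma tuple_count_decay:
  assumes pos: "0 < \<beta>" "0 < \<gamma>" and c0: "0 < c0"
    and gap: "\<And>x. x \<in> {0..1} \<Longrightarrow> P x \<Longrightarrow> c0 * x \<le> \<bar>1 - x - g_cp \<beta> \<gamma> (1 - x)\<bar>"
  shows "\<exists>c>0. \<forall>\<^sub>F n in sequentially. \<forall>k l. k \<le> n \<longrightarrow> l \<le> aux_num \<beta> n \<longrightarrow> P (real k / real n) \<longrightarrow>
    tuple_count (\<gamma> / real n) n (aux_num \<beta> n) r k l \<le> (2 * real n) ^ r * exp (- c * real (k + l))"
proof -
  obtain d where d: "0 < d" and ev: "\<forall>\<^sub>F n in sequentially. \<forall>k l. k \<le> n \<longrightarrow> l \<le> aux_num \<beta> n \<longrightarrow> P (real k / real n) \<longrightarrow>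
    d * (real (k + l) / real n) \<le> \<bar>1 - real k / real n - (1 - \<gamma> / real n) ^ l\<bar> \<or>
    d * (real (k + l) / real n) \<le> \<bar>1 - real l / real (aux_num \<beta> n) - (1 - \<gamma> / real n) ^ k\<bar>"
    using discrete_gap[OF assms, of P] by blast
  \<comment> \<open>The proportion of vertices to change. The bound \<open>d / 4\<close> serves the
    vertex side; \<open>d * \<beta> / 8\<close> serves the auxiliary side, where
    \<open>l / m \<le> 2 * l / (\<beta> * n)\<close>.\<close>
  define x where "x = min (1 / 2) (min (d / 4) (d * \<beta> / 8))"
  have x: "0 < x" "x \<le> 1 / 2" "4 * x \<le> d" "8 * x \<le> d * \<beta>"
    using d pos by (auto simp: x_def)
  define c where "c = min (x * d / 8) (x * \<beta> * d / 16)"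
  have c: "0 < c" using x d pos by (simp add: c_def)
  have "\<forall>\<^sub>F n in sequentially. max (max 1 (2 * \<gamma>)) (max (2 / \<beta>) (max (2 / x) (4 / (x * \<beta>)))) \<le> real n"
    by (rule eventually_real_ge)
  with ev have "\<forall>\<^sub>F n in sequentially. \<forall>k l. k \<le> n \<longrightarrow> l \<le> aux_num \<beta> n \<longrightarrow> P (real k / real n) \<longrightarrow>
    tuple_count (\<gamma> / real n) n (aux_num \<beta> n) r k l \<le> (2 * real n) ^ r * exp (- c * real (k + l))"
  proof eventually_elim
    case (elim n)
    then have n: "1 \<le> real n" "2 * \<gamma> \<le> real n" "2 / \<beta> \<le> real n" "2 / x \<le> real n" "4 / (x * \<beta>) \<le> real n"
      by auto
    define m p where "m = aux_num \<beta> n" and "p = \<gamma> / real n"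
    have p: "0 < p" "p < 1" using n pos by (auto simp: p_def)
    have bn: "2 \<le> \<beta> * real n" "2 \<le> x * real n" "4 \<le> x * \<beta> * real n"
      using n(3-5) pos x by (simp_all add: pos_divide_le_eq mult_ac)
    have "real m \<le> \<beta> * real n" "\<beta> * real n - 1 < real m"
      using aux_num_bounds[of \<beta> n] pos by (auto simp: m_def)
    then have m2: "\<beta> * real n / 2 \<le> real m" using bn by linarith
    then have m0: "0 < m" using bn by (metis of_nat_0_less_iff order_less_le_trans zero_less_numeral half_gt_zero)
    have xm: "x * \<beta> * real n / 2 \<le> x * real m"
      using mult_left_mono[OF m2, of x] x by (simp add: mult_ac)
    show ?case
    proof (intro allI impI, fold m_def p_def)
      fix k l assume k: "k \<le> n" and l: "l \<le> m" and P: "P (real k / real n)"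
      let ?t = "real (k + l) / real n"
      have wl: "0 < (1 - p) ^ j" "(1 - p) ^ j \<le> 1" for j
        using p by (auto intro: power_le_one)
      consider "d * ?t \<le> \<bar>1 - real k / real n - (1 - p) ^ l\<bar>"
        | "d * ?t \<le> \<bar>1 - real l / real m - (1 - p) ^ k\<bar>"
        using elim(1) k l P unfolding m_def p_def by blast
      then show "tuple_count p n m r k l \<le> (2 * real n) ^ r * exp (- c * real (k + l))"
      proof cases
        case 1
        \<comment> \<open>Here \<open>aux_num\<close> merely denotes the integer part of
          \<open>x * n\<close>.\<close>
        let ?a = "aux_num x n"
        have a: "real ?a \<le> x * real n" "x * real n / 2 \<le> real ?a"
          using aux_num_bounds[of x n] x bn by linarith+
        have "4 * x * (real k / real n) \<le> d * ?t"
          using x d by (intro mult_mono divide_right_mono) auto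
        then have "\<exists>n'. k \<le> n' \<and> n' \<le> 2 * n \<and>
            ratio n n' k ((1 - p) ^ l) \<le> exp (- real ?a * (d * ?t) / 4)"
          using 1 x(1,2) a(1) n(1) d by (intro ratio_decay[OF k wl(1,2)[of l]]) simp_all
        then obtain n' where n': "k \<le> n'" "n' \<le> 2 * n"
          "ratio n n' k ((1 - p) ^ l) \<le> exp (- real ?a * (d * ?t) / 4)"
          by blast
        have "tuple_count p n m r k l = ratio n n' k ((1 - p) ^ l) * tuple_count p n' m r k l"
          by (subst tuple_count_transfer[OF p n'(1) l]) (simp add: ratio_same[OF l wl(1)])
        also have "\<dots> \<le> exp (- real ?a * (d * ?t) / 4) * (2 * real n) ^ r"
        proof (rule mult_mono[OF n'(3)])
          have "real n' \<le> 2 * real n" using n'(2) by linarith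
          then show "tuple_count p n' m r k l \<le> (2 * real n) ^ r"
            using tuple_count_le[of p n' m r k l] power_mono[of "real n'" "2 * real n" r] by simp
        qed (auto simp: tuple_count_nonneg)
        also have "\<dots> \<le> exp (- c * real (k + l)) * (2 * real n) ^ r"
        proof (intro mult_right_mono)
          have "c * real (k + l) \<le> x * d / 8 * real (k + l)"
            unfolding c_def by (intro mult_right_mono) auto
          also have "\<dots> = (x * real n / 2) * (d * ?t) / 4" using n by simp
          also have "\<dots> \<le> real ?a * (d * ?t) / 4"
            using a d by (intro divide_right_mono mult_right_mono) auto
          finally show "exp (- real ?a * (d * ?t) / 4) \<le> exp (- c * real (k + l))" by simp
        qed auto
        finally show ?thesis by (simp add: mult.commute)
      next
        case 2
        let ?a = "aux_num x m"
        have a: "real ?a \<le> x * real m" "x * \<beta> * real n / 4 \<le> real ?a"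
          using aux_num_bounds[of x m] x bn xm by linarith+
        have "4 * x * (real l / real m) \<le> 4 * x * (real l / (\<beta> * real n / 2))"
          using m2 bn x by (intro mult_left_mono divide_left_mono) auto
        also have "\<dots> = 8 * x / \<beta> * (real l / real n)" using pos by simp
        also have "\<dots> \<le> d * ?t"
          using x d pos by (intro mult_mono divide_right_mono) (auto simp: pos_divide_le_eq)
        finally have "\<exists>m'. l \<le> m' \<and> m' \<le> 2 * m \<and>
            ratio m m' l ((1 - p) ^ k) \<le> exp (- real ?a * (d * ?t) / 4)"
          using 2 x(1,2) a(1) d by (intro ratio_decay[OF l wl(1,2)[of k] m0]) simp_all
        then obtain m' where m': "l \<le> m'"
          "ratio m m' l ((1 - p) ^ k) \<le> exp (- real ?a * (d * ?t) / 4)"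
          by blast
        have "tuple_count p n m r k l = ratio m m' l ((1 - p) ^ k) * tuple_count p n m' r k l"
          by (subst tuple_count_transfer[OF p k m'(1)]) (simp add: ratio_same[OF k wl(1)])
        also have "\<dots> \<le> exp (- real ?a * (d * ?t) / 4) * (2 * real n) ^ r"
        proof (rule mult_mono[OF m'(2)])
          show "tuple_count p n m' r k l \<le> (2 * real n) ^ r"
            using tuple_count_le[of p n m' r k l] power_mono[of "real n" "2 * real n" r] by simp
        qed (auto simp: tuple_count_nonneg)
        also have "\<dots> \<le> exp (- c * real (k + l)) * (2 * real n) ^ r"
        proof (intro mult_right_mono)
          have "c * real (k + l) \<le> x * \<beta> * d / 16 * real (k + l)"
            unfolding c_def by (intro mult_right_mono) auto
          also have "\<dots> = (x * \<beta> * real n / 4) * (d * ?t) / 4" using n by simp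
          also have "\<dots> \<le> real ?a * (d * ?t) / 4"
            using a d by (intro divide_right_mono mult_right_mono) auto
          finally show "exp (- real ?a * (d * ?t) / 4) \<le> exp (- c * real (k + l))" by simp
        qed auto
        finally show ?thesis by (simp add: mult.commute)
      qed
    qed
  qed
  then show ?thesis using c by blast
qed

section \<open>Absence of intermediate sizes\<close>

definition vnum :: "real \<Rightarrow> nat \<Rightarrow> (nat \<times> nat \<Rightarrow> bool) \<Rightarrow> nat set \<Rightarrow> nat" where
  "vnum \<beta> n B T = card (vclosure {..<n} {..<aux_num \<beta> n} B T)"

definition anum :: "real \<Rightarrow> nat \<Rightarrow> (nat \<times> nat \<Rightarrow> bool) \<Rightarrow> nat set \<Rightarrow> nat" where
  "anum \<beta> n B T = card (aclosure {..<n} {..<aux_num \<beta> n} B T)"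

lemma vnum_le: "T \<subseteq> {..<n} \<Longrightarrow> vnum \<beta> n B T \<le> n"
  unfolding vnum_def using card_mono[OF finite_lessThan vclosure_subset[of T "{..<n}"]] by simp

lemma anum_le: "anum \<beta> n B T \<le> aux_num \<beta> n"
  unfolding anum_def using card_mono[OF finite_lessThan aclosure_subset] by simp

text \<open>A union bound over pairs and sizes. Pairs cover both single components, as
  \<open>[v, v]\<close>, and unions of two components, which uniqueness of the giant
  requires.\<close>

lemma no_intermediate_components:
  assumes pos: "0 < \<beta>" "0 < \<gamma>" and c0: "0 < c0"
    and gap: "\<And>x. x \<in> {0..1} \<Longrightarrow> P x \<Longrightarrow> c0 * x \<le> \<bar>1 - x - g_cp \<beta> \<gamma> (1 - x)\<bar>"
  shows "\<exists>K. (\<lambda>n. measure_pmf.prob (rig_pmf \<beta> \<gamma> n) {B. \<exists>xs\<in>tuples 2 {..<n}.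
      P (real (vnum \<beta> n B (set xs)) / real n) \<and>
      K * ln (real n) < real (vnum \<beta> n B (set xs) + anum \<beta> n B (set xs))}) \<longlonglongrightarrow> 0"
proof -
  obtain c where c: "0 < c" and ev: "\<forall>\<^sub>F n in sequentially. \<forall>k l. k \<le> n \<longrightarrow> l \<le> aux_num \<beta> n \<longrightarrow>
      P (real k / real n) \<longrightarrow>
      tuple_count (\<gamma> / real n) n (aux_num \<beta> n) 2 k l \<le> (2 * real n)\<^sup>2 * exp (- c * real (k + l))"
    using tuple_count_decay[OF assms, of P 2] by blast
  \<comment> \<open>Beyond \<open>K * ln n\<close> the decay is at most \<open>n\<close> to the
    power -5, while the size pairs and the factor \<open>(2 * n)\<^sup>2\<close> contribute order
    \<open>n ^ 4\<close>.\<close>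
  define K where "K = 5 / c"
  let ?pr = "\<lambda>n. measure_pmf.prob (rig_pmf \<beta> \<gamma> n) {B. \<exists>xs\<in>tuples 2 {..<n}.
      P (real (vnum \<beta> n B (set xs)) / real n) \<and>
      K * ln (real n) < real (vnum \<beta> n B (set xs) + anum \<beta> n B (set xs))}"
  let ?f = "\<lambda>n::nat. (real n + 1) * (\<beta> * real n + 1) * ((2 * real n)\<^sup>2 * exp (- (5 * ln (real n))))"
  have "?pr \<longlonglongrightarrow> 0"
  proof (rule tendsto_sandwich[where f = "\<lambda>_. 0" and h = ?f])
    show "?f \<longlonglongrightarrow> 0" using pos by real_asymp
    show "\<forall>\<^sub>F n in sequentially. ?pr n \<le> ?f n"
      using ev
    proof eventually_elim
      case (elim n)
      define m where "m = aux_num \<beta> n"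
      define S where "S = {(k, l). k \<le> n \<and> l \<le> m \<and> P (real k / real n) \<and> K * ln (real n) < real (k + l)}"
      have S: "S \<subseteq> {..n} \<times> {..m}" by (auto simp: S_def)
      then have finS: "finite S" by (rule finite_subset) simp
      let ?E = "\<lambda>xs. {B. (card (vclosure {..<n} {..<m} B (set xs)), card (aclosure {..<n} {..<m} B (set xs))) \<in> S}"
      have "{B. \<exists>xs\<in>tuples 2 {..<n}. P (real (vnum \<beta> n B (set xs)) / real n) \<and>
          K * ln (real n) < real (vnum \<beta> n B (set xs) + anum \<beta> n B (set xs))} \<subseteq> (\<Union>xs\<in>tuples 2 {..<n}. ?E xs)"
      proof safe
        fix B xs
        assume xs: "xs \<in> tuples 2 {..<n}" and "P (real (vnum \<beta> n B (set xs)) / real n)"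
          "K * ln (real n) < real (vnum \<beta> n B (set xs) + anum \<beta> n B (set xs))"
        moreover have "vnum \<beta> n B (set xs) \<le> n" "anum \<beta> n B (set xs) \<le> m"
          using xs unfolding m_def by (auto intro: vnum_le anum_le simp: tuples_def)
        ultimately have "(vnum \<beta> n B (set xs), anum \<beta> n B (set xs)) \<in> S"
          unfolding S_def by blast
        then have "B \<in> ?E xs" unfolding vnum_def anum_def m_def by simp
        with xs show "B \<in> (\<Union>xs\<in>tuples 2 {..<n}. ?E xs)" by blast
      qed
      then have "?pr n \<le> measure_pmf.prob (rig_pmf \<beta> \<gamma> n) (\<Union>xs\<in>tuples 2 {..<n}. ?E xs)"
        by (intro measure_pmf.finite_measure_mono) simp_all
      also have "\<dots> \<le> (\<Sum>xs\<in>tuples 2 {..<n}. measure_pmf.prob (rig_pmf \<beta> \<gamma> n) (?E xs))"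
        by (intro measure_pmf.finite_measure_subadditive_finite finite_tuples) simp_all
      also have "\<dots> = (\<Sum>(k, l)\<in>S. tuple_count (\<gamma> / real n) n m 2 k l)"
        unfolding sum_tuple_count[OF finS] by (simp add: rig_pmf_def m_def)
      also have "\<dots> \<le> (\<Sum>z\<in>S. (2 * real n)\<^sup>2 * exp (- (5 * ln (real n))))"
      proof (intro sum_mono, clarify)
        fix k l assume kl: "(k, l) \<in> S"
        then have "tuple_count (\<gamma> / real n) n m 2 k l \<le> (2 * real n)\<^sup>2 * exp (- c * real (k + l))"
          using elim by (auto simp: S_def m_def)
        also have "\<dots> \<le> (2 * real n)\<^sup>2 * exp (- (5 * ln (real n)))"
        proof (intro mult_left_mono)
          have "c * (K * ln (real n)) \<le> c * real (k + l)"
            using kl c by (intro mult_left_mono) (auto simp: S_def)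
          then show "exp (- c * real (k + l)) \<le> exp (- (5 * ln (real n)))"
            using c by (simp add: K_def)
        qed simp
        finally show "tuple_count (\<gamma> / real n) n m 2 k l \<le> (2 * real n)\<^sup>2 * exp (- (5 * ln (real n)))" .
      qed
      also have "\<dots> = real (card S) * ((2 * real n)\<^sup>2 * exp (- (5 * ln (real n))))" by simp
      also have "\<dots> \<le> ?f n"
      proof (rule mult_right_mono)
        have "card S \<le> (n + 1) * (m + 1)"
          using card_mono[OF _ S] by (simp add: card_cartesian_product)
        then have "real (card S) \<le> real ((n + 1) * (m + 1))" by (simp only: of_nat_le_iff)
        also have "\<dots> = (real n + 1) * (real m + 1)" by (simp add: algebra_simps)
        also have "\<dots> \<le> (real n + 1) * (\<beta> * real n + 1)"
          using aux_num_bounds[of \<beta> n] pos by (intro mult_left_mono) (auto simp: m_def)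
        finally show "real (card S) \<le> (real n + 1) * (\<beta> * real n + 1)" .
      qed auto
      finally show ?case .
    qed
  qed auto
  then show ?thesis by blast
qed

section \<open>Existence of a large component\<close>

lemma vnum_anum_union:
  assumes "\<And>v. v \<in> set xs \<Longrightarrow> vnum \<beta> n B {v} + anum \<beta> n B {v} \<le> s"
  shows "vnum \<beta> n B (set xs) \<le> length xs * s" "anum \<beta> n B (set xs) \<le> length xs * s"
proof -
  have le: "card (\<Union>v\<in>set xs. F v) \<le> length xs * s" if "\<And>v. v \<in> set xs \<Longrightarrow> card (F v) \<le> s" for F :: "nat \<Rightarrow> nat set"
  proof -
    have "card (\<Union>v\<in>set xs. F v) \<le> (\<Sum>v\<in>set xs. card (F v))" by (rule card_UN_le) simp
    also have "\<dots> \<le> card (set xs) * s" using sum_bounded_above[of "set xs" "\<lambda>v. card (F v)" s] that by simp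
    also have "\<dots> \<le> length xs * s" by (intro mult_right_mono card_length) simp
    finally show ?thesis .
  qed
  show "vnum \<beta> n B (set xs) \<le> length xs * s"
    unfolding vnum_def by (subst vclosure_UN, rule le) (use assms in \<open>force simp: vnum_def\<close>)
  show "anum \<beta> n B (set xs) \<le> length xs * s"
    unfolding anum_def by (subst aclosure_UN, rule le) (use assms in \<open>force simp: anum_def\<close>)
qed

text \<open>Up to scale \<open>log n\<close>, tuples in a graph on \<open>n\<close> vertices are no more numerous than in a smaller
  graph, which has at most \<open>n'\<^sup>r\<close> of them; so \<open>r\<close> vertices are all in small components
  with probability at most \<open>(n'/n)\<^sup>r\<close>.\<close>
lemma prob_all_components_small_le:
  assumes p: "0 < p" "p < 1" and nm: "n' \<le> n" "m' \<le> m" "0 < n"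
    and n: "real n * (1 - p) ^ (m - m') + real (r * s) \<le> real n'"
    and m: "real m * (1 - p) ^ (n - n') + real (r * s) \<le> real m'"
    and Q: "\<And>B xs. Q B \<Longrightarrow> xs \<in> tuples r {..<n} \<Longrightarrow>
      card (vclosure {..<n} {..<m} B (set xs)) \<le> r * s \<and> card (aclosure {..<n} {..<m} B (set xs)) \<le> r * s"
  shows "measure_pmf.prob (bip_pmf n m p) {B. Q B} \<le> (real n' / real n) ^ r"
proof -
  define S where "S = {..r * s} \<times> {..r * s}"
  have finS: "finite S" by (simp add: S_def)
  let ?P = "measure_pmf.prob (bip_pmf n m p)"
  let ?E = "\<lambda>xs. {B. (card (vclosure {..<n} {..<m} B (set xs)), card (aclosure {..<n} {..<m} B (set xs))) \<in> S}"
  \<comment> \<open>On the event \<open>Q\<close> all \<open>n ^ r\<close> tuples are counted on the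
    right.\<close>
  have "real n ^ r * ?P {B. Q B} = (\<Sum>xs\<in>tuples r {..<n}. ?P {B. Q B})"
    by (simp add: card_tuples)
  also have "\<dots> \<le> (\<Sum>xs\<in>tuples r {..<n}. ?P (?E xs))"
    using Q by (intro sum_mono measure_pmf.finite_measure_mono) (auto simp: S_def)
  also have "\<dots> = (\<Sum>(k, l)\<in>S. tuple_count p n m r k l)"
    by (rule sum_tuple_count[OF finS, symmetric])
  also have "\<dots> \<le> (\<Sum>(k, l)\<in>S. tuple_count p n' m' r k l)"
  proof (intro sum_mono, clarify)
    fix k l assume "(k, l) \<in> S"
    then have kl: "real k \<le> real (r * s)" "real l \<le> real (r * s)" unfolding S_def of_nat_le_iff by auto
    have nn: "real n * (1 - p) ^ (m - m') \<le> real n' - real k" using n kl by linarith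
    have mm: "real m * (1 - p) ^ (n - n') \<le> real m' - real l" using m kl by linarith
    have "0 \<le> real n * (1 - p) ^ (m - m')" "0 \<le> real m * (1 - p) ^ (n - n')" using p by auto
    then have k: "k \<le> n'" and l: "l \<le> m'" using nn mm by linarith+
    have "tuple_count p n m r k l =
        ratio n n' k ((1 - p) ^ l) * ratio m m' l ((1 - p) ^ k) * tuple_count p n' m' r k l"
      by (rule tuple_count_transfer[OF p k l])
    also have "\<dots> \<le> 1 * tuple_count p n' m' r k l"
      using p k l nm nn mm by (intro mult_right_mono ratio_prod_le_1 tuple_count_nonneg) auto
    finally show "tuple_count p n m r k l \<le> tuple_count p n' m' r k l" by simp
  qed
  also have "\<dots> \<le> real n' ^ r" by (rule sum_tuple_count_le[OF finS])
  finally show ?thesis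
    using nm by (simp add: power_divide pos_le_divide_eq mult.commute)
qed

text \<open>The smaller graph has about \<open>\<sigma> * n\<close> vertices and
  \<open>\<tau> * m\<close> auxiliary vertices. In the limit the size conditions become
  \<open>exp (- \<gamma> * \<beta> * (1 - \<tau>)) < \<sigma>\<close> and
  \<open>exp (- \<gamma> * (1 - \<sigma>)) < \<tau>\<close>; they are compatible because
  \<open>g \<sigma> < \<sigma>\<close>.\<close>

lemma not_all_components_small:
  assumes pos: "0 < \<beta>" "0 < \<gamma>" and super: "1 < \<beta> * \<gamma>\<^sup>2"
  shows "(\<lambda>n. measure_pmf.prob (rig_pmf \<beta> \<gamma> n)
    {B. \<forall>v<n. real (vnum \<beta> n B {v} + anum \<beta> n B {v}) \<le> K * ln (real n)}) \<longlonglongrightarrow> 0"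
proof -
  let ?pr = "\<lambda>n. measure_pmf.prob (rig_pmf \<beta> \<gamma> n)
    {B. \<forall>v<n. real (vnum \<beta> n B {v} + anum \<beta> n B {v}) \<le> K * ln (real n)}"
  note rho = rho_ext_root[OF pos super]
  define \<sigma> where "\<sigma> = (1 + rho_ext \<beta> \<gamma>) / 2"
  have \<sigma>: "rho_ext \<beta> \<gamma> < \<sigma>" "\<sigma> < 1" "0 < \<sigma>" using rho by (auto simp: \<sigma>_def)
  define \<tau>0 where "\<tau>0 = exp (- \<gamma> * (1 - \<sigma>))"
  have \<tau>0: "0 < \<tau>0" "\<tau>0 < 1" using pos \<sigma> by (auto simp: \<tau>0_def)
  have g: "exp (- \<gamma> * \<beta> * (1 - \<tau>0)) < \<sigma>"
    using g_cp_less[OF pos super \<sigma>(1,2)] by (simp add: g_cp_def \<tau>0_def algebra_simps)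
  \<comment> \<open>Moving slightly to the right of \<open>\<tau>0\<close> makes both conditions
    strict, leaving room for rounding and for the logarithmic terms.\<close>
  obtain \<tau> where \<tau>: "\<tau>0 < \<tau>" "\<tau> < 1" "exp (- \<gamma> * \<beta> * (1 - \<tau>)) < \<sigma>"
  proof -
    have "((\<lambda>t. exp (- \<gamma> * \<beta> * (1 - t))) \<longlongrightarrow> exp (- \<gamma> * \<beta> * (1 - \<tau>0))) (at_right \<tau>0)"
      by (intro tendsto_intros)
    then have "\<forall>\<^sub>F t in at_right \<tau>0. exp (- \<gamma> * \<beta> * (1 - t)) < \<sigma>"
      using g by (rule order_tendstoD)
    moreover have "\<forall>\<^sub>F t in at_right \<tau>0. t \<in> {\<tau>0<..<1}"
      using \<tau>0 by (intro eventually_at_right_real)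
    ultimately have "\<forall>\<^sub>F t in at_right \<tau>0. \<tau>0 < t \<and> t < 1 \<and> exp (- \<gamma> * \<beta> * (1 - t)) < \<sigma>"
      by eventually_elim auto
    then show ?thesis using that eventually_happens'[OF trivial_limit_at_right_real] by blast
  qed
  have bound: "\<forall>\<^sub>F n in sequentially. ?pr n \<le> ((1 + \<sigma>) / 2) ^ r" for r
  proof -
    \<comment> \<open>The two limits treat the size conditions divided by \<open>n\<close> and by
      \<open>m\<close>; the terms \<open>- 1\<close> account for rounding.\<close>
    have lim1: "(\<lambda>n. exp (- \<gamma> / real n * ((1 - \<tau>) * (\<beta> * real n - 1) - 1)) + real r * (\<bar>K\<bar> * ln (real n)) / real n)
        \<longlonglongrightarrow> exp (- \<gamma> * \<beta> * (1 - \<tau>))"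
      using pos \<tau> by real_asymp
    have lim2: "(\<lambda>n. exp (- \<gamma> / real n * ((1 - \<sigma>) * real n - 1)) + real r * (\<bar>K\<bar> * ln (real n)) / (\<beta> * real n - 1))
        \<longlonglongrightarrow> \<tau>0"
      unfolding \<tau>0_def using pos \<sigma> by real_asymp
    have "\<forall>\<^sub>F n in sequentially. max (max 1 (2 * \<gamma>)) (max (2 / \<beta>) (2 / (1 - \<sigma>))) \<le> real n"
      by (rule eventually_real_ge)
    with order_tendstoD(2)[OF lim1 \<tau>(3)] order_tendstoD(2)[OF lim2 \<tau>(1)]
    show ?thesis
    proof eventually_elim
      case (elim n)
      have n: "1 \<le> real n" "2 * \<gamma> \<le> real n" "2 / \<beta> \<le> real n" "2 / (1 - \<sigma>) \<le> real n"
        using elim(3) by auto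
      define m p where "m = aux_num \<beta> n" and "p = \<gamma> / real n"
      define n' m' where "n' = n - aux_num (1 - \<sigma>) n" and "m' = m - aux_num (1 - \<tau>) m"
      define s where "s = nat \<lfloor>\<bar>K\<bar> * ln (real n)\<rfloor>"
      have ln0: "0 \<le> ln (real n)" using n by simp
      have s: "real s \<le> \<bar>K\<bar> * ln (real n)"
        using ln0 by (simp add: s_def)
      have bn: "2 \<le> \<beta> * real n" "2 \<le> (1 - \<sigma>) * real n"
        using n(3,4) pos \<sigma> by (simp_all add: pos_divide_le_eq mult_ac)
      have p: "0 < p" "p < 1" using n pos by (auto simp: p_def)
      have mb: "real m \<le> \<beta> * real n" "\<beta> * real n - 1 < real m"
        using aux_num_bounds[of \<beta> n] pos by (auto simp: m_def)
      have a: "real (aux_num (1 - \<sigma>) n) \<le> (1 - \<sigma>) * real n" "(1 - \<sigma>) * real n - 1 < real (aux_num (1 - \<sigma>) n)"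
        using aux_num_bounds[of "1 - \<sigma>" n] \<sigma> by auto
      have b: "real (aux_num (1 - \<tau>) m) \<le> (1 - \<tau>) * real m" "(1 - \<tau>) * real m - 1 < real (aux_num (1 - \<tau>) m)"
        using aux_num_bounds[of "1 - \<tau>" m] \<tau> by auto
      have "real (aux_num (1 - \<sigma>) n) \<le> real n"
        using a(1) mult_right_mono[of "1 - \<sigma>" 1 "real n"] \<sigma> by simp
      then have n': "n' \<le> n" "real n' = real n - real (aux_num (1 - \<sigma>) n)" "n - n' = aux_num (1 - \<sigma>) n"
        by (auto simp: n'_def)
      have "real (aux_num (1 - \<tau>) m) \<le> real m"
        using b(1) mult_right_mono[of "1 - \<tau>" 1 "real m"] \<tau> \<tau>0 by simp
      then have m': "m' \<le> m" "real m' = real m - real (aux_num (1 - \<tau>) m)" "m - m' = aux_num (1 - \<tau>) m"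
        by (auto simp: m'_def)
      have qe: "(1 - p) ^ j \<le> exp (- \<gamma> / real n * y)" if "y \<le> real j" for j y
      proof -
        have "(1 - p) ^ j \<le> exp (- p) ^ j"
          using p exp_ge_add_one_self[of "- p"] by (intro power_mono) auto
        also have "\<dots> = exp (- p * real j)" by (simp flip: exp_of_nat_mult add: mult.commute)
        also have "\<dots> \<le> exp (- \<gamma> / real n * y)"
          using mult_left_mono[OF that, of p] p by (simp add: p_def)
        finally show ?thesis .
      qed
      have rs: "real (r * s) \<le> real r * (\<bar>K\<bar> * ln (real n))"
        using s by (simp add: mult_left_mono)
      have "(1 - \<tau>) * (\<beta> * real n - 1) \<le> (1 - \<tau>) * real m"
        using mb \<tau> by (intro mult_left_mono) auto
      then have "(1 - p) ^ (m - m') \<le> exp (- \<gamma> / real n * ((1 - \<tau>) * (\<beta> * real n - 1) - 1))"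
        unfolding m'(3) using b by (intro qe) linarith
      then have "(1 - p) ^ (m - m') + real r * (\<bar>K\<bar> * ln (real n)) / real n \<le> \<sigma>"
        using elim(1) by linarith
      then have "real n * ((1 - p) ^ (m - m') + real r * (\<bar>K\<bar> * ln (real n)) / real n) \<le> real n * \<sigma>"
        by (intro mult_left_mono) auto
      then have "real n * (1 - p) ^ (m - m') + real r * (\<bar>K\<bar> * ln (real n)) \<le> real n * \<sigma>"
        using n by (simp add: distrib_left)
      moreover have "real n * \<sigma> \<le> real n'" using a n' by (simp add: algebra_simps)
      ultimately have N: "real n * (1 - p) ^ (m - m') + real (r * s) \<le> real n'"
        using rs by linarith
      have "(1 - p) ^ (n - n') \<le> exp (- \<gamma> / real n * ((1 - \<sigma>) * real n - 1))"
        unfolding n'(3) using a by (intro qe) linarith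
      then have "(1 - p) ^ (n - n') + real r * (\<bar>K\<bar> * ln (real n)) / (\<beta> * real n - 1) \<le> \<tau>"
        using elim(2) by linarith
      moreover have "real r * (\<bar>K\<bar> * ln (real n)) / real m \<le> real r * (\<bar>K\<bar> * ln (real n)) / (\<beta> * real n - 1)"
        using mb bn ln0 by (intro divide_left_mono) auto
      ultimately have "real m * ((1 - p) ^ (n - n') + real r * (\<bar>K\<bar> * ln (real n)) / real m) \<le> real m * \<tau>"
        by (intro mult_left_mono) auto
      moreover have "real m > 0" using mb bn by linarith
      ultimately have "real m * (1 - p) ^ (n - n') + real r * (\<bar>K\<bar> * ln (real n)) \<le> real m * \<tau>"
        by (simp add: distrib_left)
      moreover have "real m * \<tau> \<le> real m'" using b m' by (simp add: algebra_simps)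
      ultimately have M: "real m * (1 - p) ^ (n - n') + real (r * s) \<le> real m'"
        using rs by linarith
      have "?pr n \<le> (real n' / real n) ^ r"
        unfolding rig_pmf_def m_def[symmetric] p_def[symmetric]
      proof (rule prob_all_components_small_le[OF p n'(1) m'(1) _ N M])
        show "0 < n" using n by simp
        fix B xs
        assume small: "\<forall>v<n. real (vnum \<beta> n B {v} + anum \<beta> n B {v}) \<le> K * ln (real n)"
          and xs: "xs \<in> tuples r {..<n}"
        have "vnum \<beta> n B {v} + anum \<beta> n B {v} \<le> s" if "v \<in> set xs" for v
        proof -
          have "v < n" using that xs by (auto simp: tuples_def)
          then have "real (vnum \<beta> n B {v} + anum \<beta> n B {v}) \<le> \<bar>K\<bar> * ln (real n)"
            using small mult_right_mono[of K "\<bar>K\<bar>" "ln (real n)"] ln0 by (meson abs_ge_self order_trans)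
          then show ?thesis unfolding s_def by (simp add: le_nat_floor)
        qed
        from vnum_anum_union[OF this, of xs]
        show "card (vclosure {..<n} {..<m} B (set xs)) \<le> r * s \<and> card (aclosure {..<n} {..<m} B (set xs)) \<le> r * s"
          using xs by (auto simp: vnum_def anum_def m_def tuples_def)
      qed
      also have "\<dots> \<le> ((1 + \<sigma>) / 2) ^ r"
      proof (rule power_mono)
        \<comment> \<open>The rounding error 1 is absorbed by passing from \<open>\<sigma>\<close>
          to \<open>(1 + \<sigma>) / 2\<close>.\<close>
        have "real n' \<le> \<sigma> * real n + 1" using n' a by (simp add: algebra_simps)
        also have "\<dots> \<le> (1 + \<sigma>) / 2 * real n" using bn by (simp add: field_simps)
        finally show "real n' / real n \<le> (1 + \<sigma>) / 2" using n by (simp add: pos_divide_le_eq)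
      qed auto
      finally show ?case .
    qed
  qed
  show ?thesis
  proof (rule order_tendstoI)
    fix a :: real assume "a < 0"
    then show "\<forall>\<^sub>F n in sequentially. a < ?pr n"
      by (intro always_eventually allI) (meson measure_nonneg order_less_le_trans)
  next
    fix a :: real assume "0 < a"
    then obtain r where r: "((1 + \<sigma>) / 2) ^ r < a"
      using real_arch_pow_inv[of a "(1 + \<sigma>) / 2"] \<sigma> by auto
    from bound[of r] show "\<forall>\<^sub>F n in sequentially. ?pr n < a"
      by (rule eventually_mono) (use r in linarith)
  qed
qed

subsection \<open>The phase transition\<close>

lemma prob_tendsto_0_disj:
  fixes M :: "nat \<Rightarrow> 'a pmf"
  assumes "(\<lambda>n. measure_pmf.prob (M n) {B. P n B}) \<longlonglongrightarrow> 0"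
    and "(\<lambda>n. measure_pmf.prob (M n) {B. Q n B}) \<longlonglongrightarrow> 0"
    and "\<forall>\<^sub>F n in sequentially. \<forall>B. R n B \<longrightarrow> P n B \<or> Q n B"
  shows "(\<lambda>n. measure_pmf.prob (M n) {B. R n B}) \<longlonglongrightarrow> 0"
proof (rule tendsto_sandwich[where f = "\<lambda>_. 0"])
  show "(\<lambda>n. measure_pmf.prob (M n) {B. P n B} + measure_pmf.prob (M n) {B. Q n B}) \<longlonglongrightarrow> 0"
    using tendsto_add[OF assms(1,2)] by simp
  show "\<forall>\<^sub>F n in sequentially. measure_pmf.prob (M n) {B. R n B} \<le>
      measure_pmf.prob (M n) {B. P n B} + measure_pmf.prob (M n) {B. Q n B}"
    using assms(3)
  proof eventually_elim
    case (elim n)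
    have "measure_pmf.prob (M n) {B. R n B} \<le> measure_pmf.prob (M n) ({B. P n B} \<union> {B. Q n B})"
      using elim by (intro measure_pmf.finite_measure_mono) auto
    also have "\<dots> \<le> measure_pmf.prob (M n) {B. P n B} + measure_pmf.prob (M n) {B. Q n B}"
      by (rule measure_Un_le) auto
    finally show ?case .
  qed
qed auto

lemma prob_compl_tendsto_1:
  fixes M :: "nat \<Rightarrow> 'a pmf"
  assumes "(\<lambda>n. measure_pmf.prob (M n) {B. \<not> P n B}) \<longlonglongrightarrow> 0"
  shows "(\<lambda>n. measure_pmf.prob (M n) {B. P n B}) \<longlonglongrightarrow> 1"
proof -
  have "measure_pmf.prob (M n) {B. P n B} = 1 - measure_pmf.prob (M n) {B. \<not> P n B}" for n
    using measure_pmf.prob_compl[of "{B. \<not> P n B}" "M n"]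
    by (simp add: Compl_eq_Diff_UNIV[symmetric] Collect_neg_eq[symmetric])
  then show ?thesis using tendsto_diff[OF tendsto_const assms, of 1] by simp
qed

lemma rig_components_vnum:
  "C \<in> rig_components n (aux_num \<beta> n) B \<longleftrightarrow> (\<exists>v<n. C = vclosure {..<n} {..<aux_num \<beta> n} B {v})"
  by (auto simp: rig_components_eq)

text \<open>The case \<open>u = v\<close> is included, so the dichotomy for pairs also applies to
  single components.\<close>

lemma pair_size_le:
  assumes "\<not> (\<exists>xs\<in>tuples 2 {..<n}. P (real (vnum \<beta> n B (set xs)) / real n) \<and>
      x < real (vnum \<beta> n B (set xs) + anum \<beta> n B (set xs)))"
    and "S \<subseteq> {..<n}" "S = {u, v}" "P (real (vnum \<beta> n B S) / real n)"
  shows "real (vnum \<beta> n B S + anum \<beta> n B S) \<le> x"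
proof -
  have "[u, v] \<in> tuples 2 {..<n}" using assms by (simp add: tuples_def)
  then show ?thesis using assms by (force simp: not_less)
qed

lemma vnum_Un_disjoint:
  assumes "u < n" "v < n"
    and "vclosure {..<n} {..<aux_num \<beta> n} B {u} \<noteq> vclosure {..<n} {..<aux_num \<beta> n} B {v}"
  shows "vnum \<beta> n B {u, v} = vnum \<beta> n B {u} + vnum \<beta> n B {v}"
proof -
  let ?C = "\<lambda>x. vclosure {..<n} {..<aux_num \<beta> n} B {x}"
  have "?C u \<inter> ?C v = {}" using vclosure_eq_or_disjoint assms(3) by blast
  moreover have "finite (?C x)" if "x < n" for x
    using vclosure_subset[of "{x}" "{..<n}"] that by (intro finite_subset[of "?C x" "{..<n}"]) auto
  moreover have "vclosure {..<n} {..<aux_num \<beta> n} B {u, v} = ?C u \<union> ?C v"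
    by (auto simp: vclosure_def)
  ultimately show ?thesis using assms by (simp add: vnum_def card_Un_disjoint)
qed

lemma subcritical_components_small:
  assumes pos: "0 < \<beta>" "0 < \<gamma>" and sub: "\<beta> * \<gamma>\<^sup>2 < 1"
  shows "\<exists>K::real. (\<lambda>n. measure_pmf.prob (rig_pmf \<beta> \<gamma> n)
    {B. \<forall>C\<in>rig_components n (aux_num \<beta> n) B. real (card C) \<le> K * ln (real n)}) \<longlonglongrightarrow> 1"
proof -
  have gap: "(1 - \<beta> * \<gamma>\<^sup>2) * x \<le> \<bar>1 - x - g_cp \<beta> \<gamma> (1 - x)\<bar>" for x
    using g_cp_gap_subcritical pos by simp
  obtain K where K: "(\<lambda>n. measure_pmf.prob (rig_pmf \<beta> \<gamma> n) {B. \<exists>xs\<in>tuples 2 {..<n}. True \<and>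
      K * ln (real n) < real (vnum \<beta> n B (set xs) + anum \<beta> n B (set xs))}) \<longlonglongrightarrow> 0"
    using no_intermediate_components[OF pos, of "1 - \<beta> * \<gamma>\<^sup>2" "\<lambda>_. True"] sub gap by auto
  show ?thesis
  \<comment> \<open>With the gap valid everywhere there is one bad event only, so it fills both
    places of the disjunction.\<close>
  proof (intro exI[of _ K] prob_compl_tendsto_1 prob_tendsto_0_disj[OF K K] always_eventually allI impI)
    fix n B
    assume "\<not> (\<forall>C\<in>rig_components n (aux_num \<beta> n) B. real (card C) \<le> K * ln (real n))"
    then obtain v where v: "v < n" "K * ln (real n) < real (vnum \<beta> n B {v})"
      by (auto simp: rig_components_vnum vnum_def not_le)
    then have "[v, v] \<in> tuples 2 {..<n}" by (simp add: tuples_def)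
    moreover have "K * ln (real n) < real (vnum \<beta> n B (set [v, v]) + anum \<beta> n B (set [v, v]))"
      using v by simp
    ultimately show "(\<exists>xs\<in>tuples 2 {..<n}. True \<and>
        K * ln (real n) < real (vnum \<beta> n B (set xs) + anum \<beta> n B (set xs))) \<or>
      (\<exists>xs\<in>tuples 2 {..<n}. True \<and>
        K * ln (real n) < real (vnum \<beta> n B (set xs) + anum \<beta> n B (set xs)))"
      by blast
  qed
qed

lemma largest_comp_properties:
  assumes "0 < n"
  shows "\<exists>u<n. largest_comp n (aux_num \<beta> n) B = vnum \<beta> n B {u}"
    and "v < n \<Longrightarrow> vnum \<beta> n B {v} \<le> largest_comp n (aux_num \<beta> n) B"
proof -
  have img: "card ` rig_components n (aux_num \<beta> n) B = (\<lambda>v. vnum \<beta> n B {v}) ` {..<n}"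
    by (auto simp: rig_components_eq vnum_def image_image)
  have "Max ((\<lambda>v. vnum \<beta> n B {v}) ` {..<n}) \<in> (\<lambda>v. vnum \<beta> n B {v}) ` {..<n}"
    using assms by (intro Max_in) auto
  then show "\<exists>u<n. largest_comp n (aux_num \<beta> n) B = vnum \<beta> n B {u}"
    unfolding largest_comp_def img by auto
  show "vnum \<beta> n B {v} \<le> largest_comp n (aux_num \<beta> n) B" if "v < n"
    unfolding largest_comp_def img using that by (intro Max_ge) auto
qed

section \<open>The supercritical case\<close>

context
  fixes \<beta> \<gamma> :: real
  assumes pos: "0 < \<beta>" "0 < \<gamma>" and super: "1 < \<beta> * \<gamma>\<^sup>2"
begin

lemma supercritical_dichotomy:
  assumes "0 < \<epsilon>"
  shows "\<exists>K. (\<lambda>n. measure_pmf.prob (rig_pmf \<beta> \<gamma> n) {B. \<exists>xs\<in>tuples 2 {..<n}.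
      \<epsilon> \<le> \<bar>real (vnum \<beta> n B (set xs)) / real n - (1 - rho_ext \<beta> \<gamma>)\<bar> \<and>
      K * ln (real n) < real (vnum \<beta> n B (set xs) + anum \<beta> n B (set xs))}) \<longlonglongrightarrow> 0"
proof -
  obtain c where "c > 0" "\<And>x. x \<in> {0..1} \<Longrightarrow> \<epsilon> \<le> \<bar>x - (1 - rho_ext \<beta> \<gamma>)\<bar> \<Longrightarrow>
      c * x \<le> \<bar>1 - x - g_cp \<beta> \<gamma> (1 - x)\<bar>"
    using g_cp_gap_supercritical[OF pos super assms] by blast
  from no_intermediate_components[OF pos this] show ?thesis .
qed

lemma eventually_log_small:
  assumes "0 < \<delta>"
  shows "\<forall>\<^sub>F n in sequentially. 0 < n \<and> K * ln (real n) < \<delta> * real n"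
proof -
  have "(\<lambda>n. K * ln (real n) / real n) \<longlonglongrightarrow> 0" by real_asymp
  then have "\<forall>\<^sub>F n in sequentially. K * ln (real n) / real n < \<delta>"
    using assms by (rule order_tendstoD)
  with eventually_gt_at_top[of 0] show ?thesis
    by eventually_elim (simp add: pos_divide_less_eq)
qed

text \<open>Some component together with its auxiliary vertices exceeds the logarithmic scale, so by
  the dichotomy its vertex number is linear. The largest component is then also above that scale,
  and the dichotomy puts it near \<open>1 - \<rho>\<close>.\<close>

lemma largest_comp_concentration:
  assumes "0 < \<epsilon>"
  shows "(\<lambda>n. measure_pmf.prob (rig_pmf \<beta> \<gamma> n)
    {B. \<bar>real (largest_comp n (aux_num \<beta> n) B) / real n - (1 - rho_ext \<beta> \<gamma>)\<bar> > \<epsilon>}) \<longlonglongrightarrow> 0"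
proof -
  let ?\<rho> = "rho_ext \<beta> \<gamma>"
  note rho = rho_ext_root[OF pos super]
  \<comment> \<open>The cap \<open>(1 - \<rho>) / 2\<close> ensures that being within
    \<open>\<delta>\<close> of \<open>1 - \<rho>\<close> implies linear size.\<close>
  define \<delta> where "\<delta> = min \<epsilon> ((1 - ?\<rho>) / 2)"
  have \<delta>: "0 < \<delta>" "\<delta> \<le> \<epsilon>" "0 < 1 - ?\<rho> - \<delta>" using assms rho by (auto simp: \<delta>_def min_def)
  let ?P = "\<lambda>x. \<delta> \<le> \<bar>x - (1 - ?\<rho>)\<bar>"
  obtain K where K: "(\<lambda>n. measure_pmf.prob (rig_pmf \<beta> \<gamma> n) {B. \<exists>xs\<in>tuples 2 {..<n}.
      ?P (real (vnum \<beta> n B (set xs)) / real n) \<and>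
      K * ln (real n) < real (vnum \<beta> n B (set xs) + anum \<beta> n B (set xs))}) \<longlonglongrightarrow> 0"
    using supercritical_dichotomy[OF \<delta>(1)] by blast
  show ?thesis
  proof (rule prob_tendsto_0_disj[OF K not_all_components_small[OF pos super, of K]],
      use eventually_log_small[OF \<delta>(3), of K] in eventually_elim, intro allI impI, rule ccontr)
    fix n B
    assume n: "0 < n \<and> K * ln (real n) < (1 - ?\<rho> - \<delta>) * real n"
      and big: "\<epsilon> < \<bar>real (largest_comp n (aux_num \<beta> n) B) / real n - (1 - ?\<rho>)\<bar>"
      and "\<not> ((\<exists>xs\<in>tuples 2 {..<n}. ?P (real (vnum \<beta> n B (set xs)) / real n) \<and>
          K * ln (real n) < real (vnum \<beta> n B (set xs) + anum \<beta> n B (set xs))) \<or>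
        (\<forall>v<n. real (vnum \<beta> n B {v} + anum \<beta> n B {v}) \<le> K * ln (real n)))"
    then have D: "\<not> (\<exists>xs\<in>tuples 2 {..<n}. ?P (real (vnum \<beta> n B (set xs)) / real n) \<and>
          K * ln (real n) < real (vnum \<beta> n B (set xs) + anum \<beta> n B (set xs)))"
      and "\<exists>v<n. K * ln (real n) < real (vnum \<beta> n B {v} + anum \<beta> n B {v})"
      by (auto simp: not_le)
    then obtain v where v: "v < n" "K * ln (real n) < real (vnum \<beta> n B {v} + anum \<beta> n B {v})" by blast
    note dich = pair_size_le[OF D, of "{w}" w w for w]
    have "\<not> ?P (real (vnum \<beta> n B {v}) / real n)" using dich[of v] v by force
    then have "1 - ?\<rho> - \<delta> < real (vnum \<beta> n B {v}) / real n" by linarith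
    then have "(1 - ?\<rho> - \<delta>) * real n < real (vnum \<beta> n B {v})" using n by (simp add: pos_less_divide_eq)
    moreover obtain u where u: "u < n" "largest_comp n (aux_num \<beta> n) B = vnum \<beta> n B {u}"
      using largest_comp_properties(1) n by blast
    moreover have "vnum \<beta> n B {v} \<le> vnum \<beta> n B {u}"
      using largest_comp_properties(2)[of n v \<beta> B] n v u by simp
    ultimately have "K * ln (real n) < real (vnum \<beta> n B {u} + anum \<beta> n B {u})" using n by linarith
    moreover have "?P (real (vnum \<beta> n B {u}) / real n)" using big[unfolded u(2)] \<delta> by linarith
    ultimately show False using dich[of u] u by force
  qed
qed

lemma unique_giant:
  "\<exists>K::real. (\<lambda>n. measure_pmf.prob (rig_pmf \<beta> \<gamma> n)
    {B. \<exists>C\<in>rig_components n (aux_num \<beta> n) B. card C = largest_comp n (aux_num \<beta> n) B \<and>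
      (\<forall>C'\<in>rig_components n (aux_num \<beta> n) B. C' \<noteq> C \<longrightarrow> real (card C') \<le> K * ln (real n))})
    \<longlonglongrightarrow> 1"
proof -
  let ?\<rho> = "rho_ext \<beta> \<gamma>"
  note rho = rho_ext_root[OF pos super]
  \<comment> \<open>Two distinct large components would each have proportion above
    \<open>3 * \<delta>\<close>, so their union above \<open>6 * \<delta>\<close>; but the dichotomy
    for the union gives less than \<open>5 * \<delta>\<close>.\<close>
  define \<delta> where "\<delta> = (1 - ?\<rho>) / 4"
  have \<delta>: "0 < \<delta>" "1 - ?\<rho> = 4 * \<delta>" using rho by (auto simp: \<delta>_def)
  let ?P = "\<lambda>x. \<delta> \<le> \<bar>x - (1 - ?\<rho>)\<bar>"
  obtain K where K: "(\<lambda>n. measure_pmf.prob (rig_pmf \<beta> \<gamma> n) {B. \<exists>xs\<in>tuples 2 {..<n}.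
      ?P (real (vnum \<beta> n B (set xs)) / real n) \<and>
      K * ln (real n) < real (vnum \<beta> n B (set xs) + anum \<beta> n B (set xs))}) \<longlonglongrightarrow> 0"
    using supercritical_dichotomy[OF \<delta>(1)] by blast
  show ?thesis
  proof (rule exI[of _ K], rule prob_compl_tendsto_1,
      rule prob_tendsto_0_disj[OF K not_all_components_small[OF pos super, of K]],
      use eventually_log_small[OF \<delta>(1), of K] in eventually_elim, intro allI impI, rule ccontr)
    fix n B
    assume n: "0 < n \<and> K * ln (real n) < \<delta> * real n"
      and contra: "\<not> (\<exists>C\<in>rig_components n (aux_num \<beta> n) B. card C = largest_comp n (aux_num \<beta> n) B \<and>
        (\<forall>C'\<in>rig_components n (aux_num \<beta> n) B. C' \<noteq> C \<longrightarrow> real (card C') \<le> K * ln (real n)))"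
      and "\<not> ((\<exists>xs\<in>tuples 2 {..<n}. ?P (real (vnum \<beta> n B (set xs)) / real n) \<and>
          K * ln (real n) < real (vnum \<beta> n B (set xs) + anum \<beta> n B (set xs))) \<or>
        (\<forall>v<n. real (vnum \<beta> n B {v} + anum \<beta> n B {v}) \<le> K * ln (real n)))"
    then have D: "\<not> (\<exists>xs\<in>tuples 2 {..<n}. ?P (real (vnum \<beta> n B (set xs)) / real n) \<and>
          K * ln (real n) < real (vnum \<beta> n B (set xs) + anum \<beta> n B (set xs)))"
      and "\<exists>v<n. K * ln (real n) < real (vnum \<beta> n B {v} + anum \<beta> n B {v})"
      by (auto simp: not_le)
    then obtain v where v: "v < n" "K * ln (real n) < real (vnum \<beta> n B {v} + anum \<beta> n B {v})" by blast
    let ?C = "\<lambda>w. vclosure {..<n} {..<aux_num \<beta> n} B {w}"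
    have near: "\<bar>real (vnum \<beta> n B S) / real n - 4 * \<delta>\<bar> < \<delta>"
      if "S \<subseteq> {..<n}" "S = {u, w}" "K * ln (real n) < real (vnum \<beta> n B S + anum \<beta> n B S)" for S u w
      using pair_size_le[OF D that(1,2)] that(3) \<delta>(2) by force
    have v_near: "\<bar>real (vnum \<beta> n B {v}) / real n - 4 * \<delta>\<bar> < \<delta>"
      using near[of "{v}" v v] v by simp
    have small: "real (vnum \<beta> n B {u}) \<le> K * ln (real n)" if u: "u < n" "?C u \<noteq> ?C v" for u
    proof (rule ccontr)
      assume "\<not> ?thesis"
      then have large: "K * ln (real n) < real (vnum \<beta> n B {u})" by simp
      have eq: "vnum \<beta> n B {u, v} = vnum \<beta> n B {u} + vnum \<beta> n B {v}"
        using vnum_Un_disjoint u v by simp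
      have "\<bar>real (vnum \<beta> n B {u}) / real n - 4 * \<delta>\<bar> < \<delta>"
        using near[of "{u}" u u] u large by simp
      moreover have "\<bar>real (vnum \<beta> n B {u, v}) / real n - 4 * \<delta>\<bar> < \<delta>"
        using near[of "{u, v}" u v] u v large eq by simp
      ultimately show False using v_near \<delta> by (simp add: eq add_divide_distrib)
    qed
    have "3 * \<delta> < real (vnum \<beta> n B {v}) / real n" using v_near by linarith
    then have "3 * \<delta> * real n < real (vnum \<beta> n B {v})" using n by (simp add: pos_less_divide_eq)
    moreover have "0 < \<delta> * real n" using n \<delta> by simp
    ultimately have v_large: "K * ln (real n) < real (vnum \<beta> n B {v})" using n by linarith
    obtain u where u: "u < n" "largest_comp n (aux_num \<beta> n) B = vnum \<beta> n B {u}"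
      using largest_comp_properties(1) n by blast
    have "vnum \<beta> n B {v} \<le> vnum \<beta> n B {u}"
      using largest_comp_properties(2)[of n v \<beta> B] n v u by simp
    \<comment> \<open>The component of \<open>v\<close> is the only one above the logarithmic scale,
      so the maximum is attained there.\<close>
    then have "?C u = ?C v" using small[of u] u v_large by force
    then have "card (?C v) = largest_comp n (aux_num \<beta> n) B" using u by (simp add: vnum_def)
    moreover have "real (card C') \<le> K * ln (real n)"
      if C': "C' \<in> rig_components n (aux_num \<beta> n) B" "C' \<noteq> ?C v" for C'
    proof -
      obtain w where "w < n" "C' = ?C w" using C'(1) by (auto simp: rig_components_vnum)
      then show ?thesis using small[of w] C'(2) by (simp add: vnum_def)
    qed
    moreover have "?C v \<in> rig_components n (aux_num \<beta> n) B"
      using v by (auto simp: rig_components_vnum)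
    ultimately show False using contra by blast
  qed
qed

end

theorem theorem1:
  fixes \<beta> \<gamma> :: real
  assumes "\<beta> > 0" and "\<gamma> > 0"
  shows
   "(\<beta> * \<gamma>\<^sup>2 < 1 \<longrightarrow>
      (\<exists>K::real. (\<lambda>n. measure_pmf.prob (rig_pmf \<beta> \<gamma> n)
          {B. \<forall>C\<in>rig_components n (aux_num \<beta> n) B. real (card C) \<le> K * ln (real n)})
        \<longlonglongrightarrow> 1))
  \<and> (\<beta> * \<gamma>\<^sup>2 > 1 \<longrightarrow>
      0 < rho_ext \<beta> \<gamma> \<and> rho_ext \<beta> \<gamma> < 1
    \<and> (\<forall>\<epsilon>>0. (\<lambda>n. measure_pmf.prob (rig_pmf \<beta> \<gamma> n)
          {B. \<bar>real (largest_comp n (aux_num \<beta> n) B) / real n - (1 - rho_ext \<beta> \<gamma>)\<bar> > \<epsilon>})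
        \<longlonglongrightarrow> 0)
    \<and> (\<exists>K::real. (\<lambda>n. measure_pmf.prob (rig_pmf \<beta> \<gamma> n)
          {B. \<exists>C\<in>rig_components n (aux_num \<beta> n) B.
                card C = largest_comp n (aux_num \<beta> n) B \<and>
                (\<forall>C'\<in>rig_components n (aux_num \<beta> n) B. C' \<noteq> C \<longrightarrow>
                    real (card C') \<le> K * ln (real n))})
        \<longlonglongrightarrow> 1))"
  using subcritical_components_small[OF assms] rho_ext_root(1,2)[OF assms] largest_comp_concentration[OF assms]
    unique_giant[OF assms]
  by blast

end
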